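(* Let $m\ge 2$ be an integer. Then \[ \sum_{\mu\in\mathcal{P}}t^{h_{m-1,1}(\mu)}q^{|\mu|} =\sum_{\{s_i\} \in \mathcal{S}_m} q^{(m-1)\binom{s_1}{2} + \sum_i s_i} \prod_{j\geq 1} \left[{s_j - s_{j+m} + \chi (m-1 \mid j) \atop s_{j+1} - s_{j+m}}\right]_t . \]
   Context: $\mathcal{P}$ is the set of all partitions, viewed as Young diagrams; $|\mu|$ is the number of cells. For a cell $v$, $a_v$ (arm length) is the number of cells to its right in its row and $l_v$ (leg length) the number of cells below it in its column. For non-negative integers $\alpha,\beta$, not both zero, $h_{\alpha,\beta}(\mu)$ is the number of cells $v$ of $\mu$ with $\alpha l_v=\beta(a_v+1)$ and $(\alpha+\beta)\mid a_v+l_v+1$. $\chi(P)$ is $1$ if statement $P$ holds and $0$ otherwise. $\mathcal{S}_m$ is the set of sequences $\{s_i\}_{i>0}$ of non-negative integers, only finitely many nonzero, such that $s_i \geq s_{i+1} - \chi (m-1 \mid i)$ and $s_i \geq s_{i+(m-1)}$ for all $i\ge 1$. $\left[{a\atop b}\right]_t$ denotes the Gaussian ($t$-)binomial coefficient, taken to be $0$ if an entry is negative or $b>a$. *)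

theory Defs
  imports
    "HOL-Analysis.Infinite_Sum"
    "HOL-Library.Groups_Big_Fun"
    "HOL-Computational_Algebra.Polynomial"
    "HOL-Computational_Algebra.Formal_Power_Series"
begin

section \<open>Partitions as Young diagrams\<close>

text \<open>A partition is the weakly decreasing list of its (positive) parts. Its diagram is drawn with
  row \<open>i\<close> of length \<open>\<mu> ! i\<close> and rows going downwards; a cell is a pair \<open>(row, column)\<close>, both counted
  from 0.\<close>

definition partitions :: "nat list set" where
  "partitions = {\<mu>. sorted_wrt (\<ge>) \<mu> \<and> (\<forall>x\<in>set \<mu>. x > 0)}"

definition cells :: "nat list \<Rightarrow> (nat \<times> nat) set" where
  "cells \<mu> = {(i, j). i < length \<mu> \<and> j < \<mu> ! i}"

definition psize :: "nat list \<Rightarrow> nat" where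
  "psize \<mu> = card (cells \<mu>)"

definition arm :: "nat list \<Rightarrow> nat \<times> nat \<Rightarrow> nat" where
  "arm \<mu> v = card {w \<in> cells \<mu>. fst w = fst v \<and> snd w > snd v}"

definition leg :: "nat list \<Rightarrow> nat \<times> nat \<Rightarrow> nat" where
  "leg \<mu> v = card {w \<in> cells \<mu>. snd w = snd v \<and> fst w > fst v}"

definition h_count :: "nat \<Rightarrow> nat \<Rightarrow> nat list \<Rightarrow> nat" where
  "h_count \<alpha> \<beta> \<mu> = card {v \<in> cells \<mu>. \<alpha> * leg \<mu> v = \<beta> * (arm \<mu> v + 1) \<and>
                                (\<alpha> + \<beta>) dvd (arm \<mu> v + leg \<mu> v + 1)}"

section \<open>Gaussian binomial coefficients\<close>

definition t_poch :: "nat \<Rightarrow> int poly" where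
  "t_poch n = (\<Prod>i = 1..n. 1 - monom 1 i)"

text \<open>The division of polynomials is exact, see \<open>gauss_binomial_exact\<close>.\<close>

definition gauss_binomial :: "int \<Rightarrow> int \<Rightarrow> int poly" where
  "gauss_binomial a b =
     (if 0 \<le> b \<and> b \<le> a
      then t_poch (nat a) div (t_poch (nat b) * t_poch (nat (a - b)))
      else 0)"

lemma t_poch_Suc: "t_poch (Suc n) = t_poch n * (1 - monom 1 (Suc n))"
  by (simp add: t_poch_def)

lemma t_poch_0 [simp]: "t_poch 0 = 1"
  by (simp add: t_poch_def)

lemma t_poch_nonzero: "t_poch n \<noteq> 0"
proof -
  have "1 - monom (1::int) i \<noteq> 0" if "i \<ge> 1" for i
  proof
    assume "1 - monom (1::int) i = 0"
    then have "coeff (1 - monom (1::int) i) 0 = 0" by simp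
    with that show False by simp
  qed
  then show ?thesis by (auto simp: t_poch_def)
qed

lemma t_poch_dvd: "t_poch b * t_poch c dvd t_poch (b + c)"
proof (induction "b + c" arbitrary: b c)
  case 0
  then show ?case by simp
next
  case (Suc n)
  show ?case
  proof (cases "b = 0 \<or> c = 0")
    case True
    then show ?thesis by auto
  next
    case False
    then obtain b' c' where bc: "b = Suc b'" "c = Suc c'"
      by (metis not0_implies_Suc)
    have 1: "t_poch b' * t_poch c dvd t_poch n"
      using Suc.hyps(1)[of b' c] Suc.hyps(2) bc by simp
    have 2: "t_poch b * t_poch c' dvd t_poch n"
      using Suc.hyps(1)[of b c'] Suc.hyps(2) bc by simp
    have "t_poch b * t_poch c dvd t_poch n * (1 - monom 1 b)"
      using mult_dvd_mono[OF 1 dvd_refl[of "1 - monom 1 b"]] bc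
      by (simp add: t_poch_Suc mult_ac)
    moreover have "t_poch b * t_poch c dvd t_poch n * (1 - monom 1 c)"
      using mult_dvd_mono[OF 2 dvd_refl[of "1 - monom 1 c"]] bc
      by (simp add: t_poch_Suc mult_ac)
    ultimately have "t_poch b * t_poch c dvd
        t_poch n * (1 - monom 1 b) + monom 1 b * (t_poch n * (1 - monom 1 c))"
      using dvd_add dvd_mult by blast
    also have "\<dots> = t_poch n * (1 - monom 1 b * monom 1 c)"
      by (simp add: algebra_simps)
    also have "\<dots> = t_poch (b + c)"
      using Suc.hyps(2) by (simp add: mult_monom flip: t_poch_Suc Suc.hyps(2))
    finally show ?thesis .
  qed
qed

lemma gauss_binomial_exact:
  assumes "0 \<le> b" "b \<le> a"
  shows "gauss_binomial a b * (t_poch (nat b) * t_poch (nat (a - b))) = t_poch (nat a)"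
  using assms t_poch_dvd[of "nat b" "nat (a - b)"]
  by (simp add: gauss_binomial_def flip: nat_add_distrib)

lemma gauss_binomial_0_right: "a \<ge> 0 \<Longrightarrow> gauss_binomial a 0 = 1"
  by (simp add: gauss_binomial_def t_poch_nonzero)

section \<open>The sequences and their weights\<close>

text \<open>Sequences are indexed by \<open>i > 0\<close>; the value at the unused index 0 is fixed to be 0, so that a
  sequence is represented by exactly one function.\<close>

definition seqs :: "nat \<Rightarrow> (nat \<Rightarrow> nat) set" where
  "seqs m = {s. s 0 = 0 \<and> finite {i. s i \<noteq> 0} \<and>
     (\<forall>i\<ge>1. int (s i) \<ge> int (s (i + 1)) - of_bool ((m - 1) dvd i) \<and>
            s i \<ge> s (i + (m - 1)))}"

definition factor :: "nat \<Rightarrow> (nat \<Rightarrow> nat) \<Rightarrow> nat \<Rightarrow> int poly" where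
  "factor m s j =
     gauss_binomial (int (s j) - int (s (j + m)) + of_bool ((m - 1) dvd j))
                    (int (s (j + 1)) - int (s (j + m)))"

text \<open>All but finitely many of the factors are 1, so \<^const>\<open>Prod_any\<close> in the definition of
  \<open>weight\<close> is the intended infinite product.\<close>

lemma finite_factor_neq_1:
  assumes "s \<in> seqs m"
  shows "finite {j. factor m s j \<noteq> 1}"
proof -
  let ?A = "{i. s i \<noteq> 0}"
  have "finite (?A \<union> (\<lambda>i. i - 1) ` ?A \<union> (\<lambda>i. i - m) ` ?A)"
    using assms by (simp add: seqs_def)
  moreover have "{j. factor m s j \<noteq> 1} \<subseteq> ?A \<union> (\<lambda>i. i - 1) ` ?A \<union> (\<lambda>i. i - m) ` ?A"
  proof
    fix j assume j: "j \<in> {j. factor m s j \<noteq> 1}"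
    have "s j \<noteq> 0 \<or> s (j + 1) \<noteq> 0 \<or> s (j + m) \<noteq> 0"
    proof (rule ccontr)
      assume "\<not> ?thesis"
      then have "factor m s j = 1"
        by (simp add: factor_def gauss_binomial_0_right)
      with j show False by simp
    qed
    then show "j \<in> ?A \<union> (\<lambda>i. i - 1) ` ?A \<union> (\<lambda>i. i - m) ` ?A"
    proof (elim disjE)
      assume "s (j + 1) \<noteq> 0"
      then have "(j + 1) - 1 \<in> (\<lambda>i. i - 1) ` ?A" by blast
      then show ?thesis by simp
    next
      assume "s (j + m) \<noteq> 0"
      then have "(j + m) - m \<in> (\<lambda>i. i - m) ` ?A" by blast
      then show ?thesis by simp
    qed simp
  qed
  ultimately show ?thesis by (rule rev_finite_subset)
qed

definition weight :: "nat \<Rightarrow> (nat \<Rightarrow> nat) \<Rightarrow> int poly" where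
  "weight m s = Prod_any (\<lambda>j. if j \<ge> 1 then factor m s j else 1)"

end

theory Submission
  imports Defs
begin

text \<open>Put \<open>N = m - 1\<close>, give the cell in row \<open>i\<close> and column \<open>j\<close> the weight \<open>N * i + j\<close>, and let \<open>d q\<close> be
  the number of cells of weight \<open>q\<close>. Up to an initial segment on which \<open>d\<close> is as large as possible,
  the possible functions \<open>d\<close> are exactly the sequences in \<open>S\<^sub>m\<close>, and \<open>s\<^sub>1\<close> measures the length of
  that segment. So it suffices to show, for fixed \<open>d\<close>, that \<open>t\<^sup>h\<close> summed over the partitions with
  these weight counts is the product of Gaussian binomials, that is, the inversion generating
  function of families of binary words \<open>w q\<close> with \<open>d q - d (q + N)\<close> letters \<open>True\<close> and
  \<open>d (q - 1) + \<chi>(N dvd q) - d q\<close> letters \<open>False\<close>.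

  The bijection is a version of the hook code of Iarrobino and Yameogo, built row by row. The cells
  counted by \<open>h\<close> in a first row of length \<open>L\<close> number \<open>d L - d (L + N)\<close>. On words, removing this row
  deletes the first letter of \<open>w q\<close> for \<open>L - N \<le> q \<le> L\<close>, which is \<open>False\<close> for \<open>q = L\<close> and \<open>True\<close>
  otherwise. Conversely \<open>L\<close> is recovered as the largest place at which this pattern of
  first letters occurs, and the next row is at most as long since a later pattern of the
  stripped words would shift back to a later pattern of the original ones.\<close>

section \<open>Binary words and inversions\<close>

definition words :: "nat \<Rightarrow> nat \<Rightarrow> bool list set" where
  "words b z = {ws. count_list ws True = b \<and> count_list ws False = z}"

fun inversions :: "bool list \<Rightarrow> nat" where
  "inversions [] = 0"
| "inversions (x # ws) = inversions ws + (if x then 0 else count_list ws True)"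

lemma length_eq_counts: "length ws = count_list ws True + count_list ws False"
  by (induction ws) auto

lemma words_0_right [simp]: "words b 0 = {replicate b True}"
proof -
  have "ws = replicate (count_list ws True) True" if "count_list ws False = 0" for ws
    using that by (induction ws) (auto split: if_splits)
  moreover have "count_list (replicate b x) y = (if x = y then b else 0)" for x y :: bool
    by (induction b) auto
  ultimately show ?thesis by (auto simp: words_def)
qed

lemma words_0_left [simp]: "words 0 z = {replicate z False}"
proof -
  have "ws = replicate (count_list ws False) False" if "count_list ws True = 0" for ws
    using that by (induction ws) (auto split: if_splits)
  moreover have "count_list (replicate b x) y = (if x = y then b else 0)" for x y :: bool and b
    by (induction b) auto
  ultimately show ?thesis by (auto simp: words_def)
qed

lemma words_Suc_Suc:
  "words (Suc b) (Suc z) = (#) True ` words b (Suc z) \<union> (#) False ` words (Suc b) z"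
proof (intro set_eqI iffI)
  fix ws assume "ws \<in> words (Suc b) (Suc z)"
  then show "ws \<in> (#) True ` words b (Suc z) \<union> (#) False ` words (Suc b) z"
    by (cases ws) (auto simp: words_def split: if_splits)
qed (auto simp: words_def)

lemma finite_words [simp]: "finite (words b z)"
proof (rule finite_subset)
  show "words b z \<subseteq> {ws. set ws \<subseteq> UNIV \<and> length ws = b + z}"
    by (auto simp: words_def length_eq_counts)
qed (rule finite_lists_length_eq, simp)

lemma inversions_replicate [simp]: "inversions (replicate n x) = 0"
proof -
  have "count_list (replicate b False) True = 0" for b
    by (induction b) auto
  then show ?thesis by (induction n) auto
qed

text \<open>Splitting off the first letter gives the Pascal recurrence: a leading
  \<open>True\<close> causes no inversion, a leading \<open>False\<close> one for each
  \<open>True\<close>. The identity is multiplied out so that the induction involves no polynomial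
  division.\<close>

lemma sum_words_t_poch:
  "(\<Sum>ws\<in>words b z. monom (1::int) (inversions ws)) * (t_poch b * t_poch z) = t_poch (b + z)"
proof (induction "b + z" arbitrary: b z)
  case 0
  then show ?case by simp
next
  case (Suc n)
  show ?case
  proof (cases "b = 0 \<or> z = 0")
    case True
    then show ?thesis by (auto simp: monom_0)
  next
    case False
    then obtain b' z' where bz: "b = Suc b'" "z = Suc z'"
      by (metis not0_implies_Suc)
    let ?S = "\<lambda>b z. \<Sum>ws\<in>words b z. monom (1::int) (inversions ws)"
    have 1: "?S b' z * (t_poch b' * t_poch z) = t_poch n"
      using Suc.hyps(1)[of b' z] Suc.hyps(2) bz by simp
    have 2: "?S b z' * (t_poch b * t_poch z') = t_poch n"
      using Suc.hyps(1)[of b z'] Suc.hyps(2) bz by simp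
    have "?S b z = (\<Sum>ws\<in>(#) True ` words b' z. monom 1 (inversions ws))
                 + (\<Sum>ws\<in>(#) False ` words b z'. monom 1 (inversions ws))"
      unfolding bz words_Suc_Suc by (rule sum.union_disjoint) auto
    also have "(\<Sum>ws\<in>(#) True ` words b' z. monom 1 (inversions ws)) = ?S b' z"
      by (subst sum.reindex) auto
    also have "(\<Sum>ws\<in>(#) False ` words b z'. monom 1 (inversions ws)) = ?S b z' * monom 1 b"
      unfolding sum_distrib_right
      by (subst sum.reindex) (auto simp: mult_monom words_def intro!: sum.cong)
    finally have S: "?S b z = ?S b' z + ?S b z' * monom 1 b" .
    have "?S b z * (t_poch b * t_poch z) =
        ?S b' z * (t_poch b' * t_poch z) * (1 - monom 1 b)
        + ?S b z' * (t_poch b * t_poch z') * (monom 1 b * (1 - monom 1 z))"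
      unfolding S by (simp add: bz t_poch_Suc algebra_simps)
    also have "\<dots> = t_poch n * (1 - monom 1 b * monom 1 z)"
      unfolding 1 2 by (simp add: algebra_simps)
    also have "\<dots> = t_poch (b + z)"
      using Suc.hyps(2) by (simp add: mult_monom flip: t_poch_Suc Suc.hyps(2))
    finally show ?thesis .
  qed
qed

lemma sum_words:
  "(\<Sum>ws\<in>words b z. monom 1 (inversions ws)) = gauss_binomial (int (b + z)) (int b)"
proof -
  have "(\<Sum>ws\<in>words b z. monom (1::int) (inversions ws)) * (t_poch b * t_poch z)
      = gauss_binomial (int (b + z)) (int b) * (t_poch b * t_poch z)"
    using gauss_binomial_exact[of "int b" "int (b + z)"] by (simp add: sum_words_t_poch nat_int_add)
  then show ?thesis by (simp add: t_poch_nonzero)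
qed

section \<open>Weight counts and codes\<close>

locale weighted =
  fixes N :: nat
  assumes N_pos: "N > 0"
begin

text \<open>The number of cells of weight \<open>q\<close> in the whole quadrant, where the cell in row \<open>i\<close> and column
  \<open>j\<close> has weight \<open>N * i + j\<close>.\<close>

definition full :: "nat \<Rightarrow> nat" where
  "full q = q div N + 1"

definition admissible :: "(nat \<Rightarrow> nat) \<Rightarrow> bool" where
  "admissible d \<longleftrightarrow> d 0 \<le> 1 \<and> (\<forall>q. d (Suc q) \<le> d q + of_bool (N dvd Suc q)) \<and>
     (\<forall>q. d (q + N) \<le> d q \<or> d (q + N) = full (q + N))"

text \<open>The subtraction is truncated exactly when \<open>d (q + N)\<close> is full; such words are empty.\<close>

definition ones :: "(nat \<Rightarrow> nat) \<Rightarrow> nat \<Rightarrow> nat" where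
  "ones d q = d q - d (q + N)"

definition zeros :: "(nat \<Rightarrow> nat) \<Rightarrow> nat \<Rightarrow> nat" where
  "zeros d q = (if q = 0 then 0 else d (q - 1)) + of_bool (N dvd q) - d q"

definition codes :: "(nat \<Rightarrow> nat) \<Rightarrow> (nat \<Rightarrow> bool list) set" where
  "codes d = {w. \<forall>q. w q \<in> words (ones d q) (zeros d q)}"

text \<open>Full weights count as leading with \<open>True\<close>, even if their word is empty: the untruncated
  exponent of \<open>True\<close> may then be \<open>-1\<close>, and prepending \<open>True\<close> to such a word gives the empty word.\<close>

definition leads :: "(nat \<Rightarrow> nat) \<Rightarrow> (nat \<Rightarrow> bool list) \<Rightarrow> nat \<Rightarrow> bool" where
  "leads d w q \<longleftrightarrow> d q = full q \<or> (\<exists>v. w q = True # v)"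

definition pat :: "(nat \<Rightarrow> nat) \<Rightarrow> (nat \<Rightarrow> bool list) \<Rightarrow> nat \<Rightarrow> bool" where
  "pat d w L \<longleftrightarrow> (\<exists>v. w L = False # v) \<and> (\<forall>q<L. L \<le> q + N \<longrightarrow> leads d w q)"

definition top_pat :: "(nat \<Rightarrow> nat) \<Rightarrow> (nat \<Rightarrow> bool list) \<Rightarrow> nat \<Rightarrow> bool" where
  "top_pat d w L \<longleftrightarrow> pat d w L \<and> (\<forall>M. pat d w M \<longrightarrow> M \<le> L)"

definition drop_row :: "nat \<Rightarrow> (nat \<Rightarrow> nat) \<Rightarrow> nat \<Rightarrow> nat" where
  "drop_row L d q = d (q + N) - of_bool (q + N < L)"

definition strip :: "nat \<Rightarrow> (nat \<Rightarrow> bool list) \<Rightarrow> nat \<Rightarrow> bool list" where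
  "strip L w q = (if L \<le> q + 2 * N \<and> q + N \<le> L then tl (w (q + N)) else w (q + N))"

section \<open>Growth of admissible weight counts\<close>

lemma full_Suc: "full (Suc q) = full q + of_bool (N dvd Suc q)"
  by (auto simp: full_def div_Suc dvd_eq_mod_eq_0)

lemma full_add: "full (q + N) = full q + 1"
  using N_pos by (simp add: full_def)

lemma full_mono: "p \<le> q \<Longrightarrow> full p \<le> full q"
  by (simp add: full_def div_le_mono)

lemma full_less: "q < N \<Longrightarrow> full q = 1"
  by (simp add: full_def)

text \<open>The deficiency \<open>full q - d q\<close> never decreases, because \<open>full\<close>
  always takes the largest step that \<open>d\<close> may take. Hence the full weights form an
  initial segment.\<close>

lemma admissible_grow:
  assumes "admissible d" "p \<le> q"
  shows "d q + full p \<le> d p + full q"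
  using assms(2)
proof (induction q rule: dec_induct)
  case (step q)
  have "d (Suc q) \<le> d q + of_bool (N dvd Suc q)"
    using assms(1) by (simp add: admissible_def)
  with step.IH show ?case by (simp add: full_Suc)
qed simp

lemma admissible_le_full:
  assumes "admissible d"
  shows "d q \<le> full q"
  using admissible_grow[OF assms, of 0 q] assms by (simp add: admissible_def full_def)

lemma admissible_full_down:
  assumes "admissible d" "d q = full q" "p \<le> q"
  shows "d p = full p"
  using admissible_grow[OF assms(1,3)] admissible_le_full[OF assms(1), of p] assms(2) by simp

lemma admissible_add_le:
  assumes "admissible d" "d p \<noteq> full p" "p \<le> q + N"
  shows "d (q + N) \<le> d q"
  using assms admissible_full_down[of d "q + N" p] by (auto simp: admissible_def)

lemma admissible_zeros:
  assumes "admissible d"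
  shows "zeros d q + d q = (if q = 0 then 0 else d (q - 1)) + of_bool (N dvd q)"
  using assms by (cases q) (auto simp: admissible_def zeros_def)

lemma zeros_full: 
  assumes "admissible d" "d q = full q"
  shows "zeros d q = 0"
proof (cases q)
  case 0
  then show ?thesis using assms by (simp add: zeros_def full_def)
next
  case (Suc p)
  then show ?thesis using assms admissible_le_full[of d p] by (simp add: zeros_def full_Suc)
qed

text \<open>The deficiency at \<open>0\<close> rules out full weights, so values descend in steps of
  \<open>N\<close> to weights below \<open>N\<close>, where \<open>full\<close> is constantly
  \<open>1\<close> and \<open>d\<close> must vanish.\<close>

lemma admissible_eq_0:
  assumes "admissible d" "d 0 = 0"
  shows "d q = 0"
proof (induction q rule: less_induct)
  case (less q)
  have nf: "d 0 \<noteq> full 0" using assms by (simp add: full_def)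
  show ?case
  proof (cases "q < N")
    case True
    then have "full q = 1" "full 0 = 1" by (simp_all add: full_def)
    then show ?thesis using admissible_grow[OF assms(1), of 0 q] assms(2) by linarith
  next
    case False
    then show ?thesis
      using admissible_add_le[OF assms(1) nf, of "q - N"] less[of "q - N"] N_pos by simp
  qed
qed

section \<open>First letters of words and the top pattern\<close>

lemma codes_leads_Cons:
  assumes "w \<in> codes d" "leads d w q" "d q \<noteq> full q"
  obtains v where "w q = True # v" "ones d q > 0" "d (q + N) < d q"
proof -
  obtain v where v: "w q = True # v"
    using assms by (auto simp: leads_def)
  moreover have "w q \<in> words (ones d q) (zeros d q)"
    using assms by (simp add: codes_def)
  ultimately show ?thesis
    using that by (auto simp: words_def ones_def)
qed

lemma codes_Cons_False:
  assumes "w \<in> codes d" "w q = False # v"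
  shows "zeros d q > 0"
proof -
  have "w q \<in> words (ones d q) (zeros d q)"
    using assms(1) by (simp add: codes_def)
  then show ?thesis using assms(2) by (auto simp: words_def)
qed

text \<open>The least place \<open>L\<close> that does not lead carries a pattern, once its word is
  known to be nonempty.\<close>

lemma pat_exists:
  assumes "admissible d" "w \<in> codes d" "\<And>q. q \<ge> Q \<Longrightarrow> d q = 0"
  shows "\<exists>L. pat d w L"
proof -
  have "\<not> leads d w Q"
  proof
    assume *: "leads d w Q"
    have "d Q \<noteq> full Q" using assms(3)[of Q] by (simp add: full_def)
    from codes_leads_Cons[OF assms(2) * this] show False
      using assms(3)[of Q] by (auto simp: ones_def)
  qed
  then obtain L where L: "\<not> leads d w L" and lt: "\<And>q. q < L \<Longrightarrow> leads d w q"
    using exists_least_iff[of "\<lambda>q. \<not> leads d w q"] by blast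
  have nf: "d L \<noteq> full L" using L by (simp add: leads_def)
  have wL: "w L \<in> words (ones d L) (zeros d L)" using assms(2) by (simp add: codes_def)
  have "w L \<noteq> []"
  proof
    assume "w L = []"
    then have z: "zeros d L = 0" and o: "ones d L = 0" using wL by (auto simp: words_def)
    show False
    proof (cases L)
      case 0
      then show ?thesis using z nf admissible_le_full[OF assms(1), of 0]
        by (simp add: zeros_def full_def)
    next
      \<comment> \<open>An empty word forces maximal growth from \<open>p\<close> to
        \<open>L\<close> and no drop from \<open>L\<close> to \<open>L + N\<close>. But
        \<open>d\<close> drops strictly from \<open>p\<close> to \<open>p + N\<close>, and its
        growth from \<open>p + N\<close> to \<open>L + N\<close> obeys the same bound, so it must
        drop from \<open>L\<close> to \<open>L + N\<close> too.\<close>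
      case (Suc p)
      have le: "d p + of_bool (N dvd Suc p) \<le> d (Suc p)"
        using z Suc by (simp add: zeros_def)
      then have nfp: "d p \<noteq> full p"
        using nf Suc admissible_le_full[OF assms(1), of "Suc p"] by (simp add: full_Suc)
      have "leads d w p" using lt Suc by simp
      then have "d (p + N) < d p"
        using codes_leads_Cons[OF assms(2)] nfp by metis
      moreover have "d (Suc (p + N)) \<le> d (p + N) + of_bool (N dvd Suc (p + N))"
        using assms(1) by (simp add: admissible_def)
      moreover have "N dvd Suc (p + N) \<longleftrightarrow> N dvd Suc p"
        using dvd_add_left_iff[of N N "Suc p"] by simp
      ultimately show ?thesis using o le Suc by (simp add: ones_def)
    qed
  qed
  moreover have "\<nexists>v. w L = True # v" using L by (simp add: leads_def)
  ultimately have "\<exists>v. w L = False # v" by (cases "w L") auto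
  then show ?thesis using lt by (auto simp: pat_def)
qed

text \<open>The place just below \<open>L\<close> lies in the window and has to lead, which needs a
  positive count.\<close>

lemma pat_bound:
  assumes "w \<in> codes d" "\<And>q. q \<ge> Q \<Longrightarrow> d q = 0" "pat d w L"
  shows "L \<le> Q"
proof (rule ccontr)
  assume "\<not> L \<le> Q"
  then have *: "leads d w (L - 1)" "d (L - 1) = 0"
    using assms(2,3) N_pos by (auto simp: pat_def)
  then show False using codes_leads_Cons[OF assms(1) *(1)] by (auto simp: full_def)
qed

lemma top_pat_exists:
  assumes "admissible d" "w \<in> codes d" "\<And>q. q \<ge> Q \<Longrightarrow> d q = 0"
  obtains L where "top_pat d w L" "L \<le> Q"
proof -
  have fin: "finite {L. pat d w L}"
    using pat_bound[OF assms(2,3)] by (auto intro: finite_subset[of _ "{..Q}"])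
  have ne: "{L. pat d w L} \<noteq> {}"
    using pat_exists[OF assms] by blast
  have "top_pat d w (Max {L. pat d w L})"
    using Max_in[OF fin ne] Max_ge[OF fin] by (auto simp: top_pat_def)
  moreover have "Max {L. pat d w L} \<le> Q"
    using Max_in[OF fin ne] pat_bound[OF assms(2,3)] by blast
  ultimately show ?thesis using that by blast
qed

lemma top_pat_unique: "top_pat d w L \<Longrightarrow> top_pat d w M \<Longrightarrow> L = M"
  by (meson le_antisym top_pat_def)

end

section \<open>Removing and adding a row on codes\<close>

context weighted
begin

text \<open>Necessary conditions for a first row of length \<open>L\<close>: weights below
  \<open>N\<close> occur only in that row, and positivity below \<open>L\<close> keeps the
  subtraction in \<open>drop_row\<close> from truncating.\<close>

definition extends :: "nat \<Rightarrow> (nat \<Rightarrow> nat) \<Rightarrow> bool" where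
  "extends L d \<longleftrightarrow> L > 0 \<and> (\<forall>q<N. d q = of_bool (q < L)) \<and> (\<forall>q<L. d q > 0)"

lemma pat_not_full:
  assumes "admissible d" "w \<in> codes d" "pat d w L"
  shows "d L \<noteq> full L"
  using assms zeros_full[of d L] codes_Cons_False[of w d L] by (fastforce simp: pat_def)

text \<open>Inside the window a leading \<open>True\<close> needs a positive count; below the window
  positivity descends in steps of \<open>N\<close>.\<close>

lemma pat_pos:
  assumes "admissible d" "w \<in> codes d" "pat d w L" "q < L"
  shows "d q > 0"
  using assms(4)
proof (induction "L - q" arbitrary: q rule: less_induct)
  case less
  show ?case
  proof (cases "d q = full q")
    case True
    then show ?thesis by (simp add: full_def)
  next
    case False
    show ?thesis
    proof (cases "L \<le> q + N")
      case True
      then have "leads d w q" using assms(3) less.prems by (simp add: pat_def)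
      then show ?thesis using codes_leads_Cons[OF assms(2) _ False] by fastforce
    next
      case gt: False
      then have "d (q + N) > 0" using less.hyps[of "q + N"] N_pos by simp
      then show ?thesis using admissible_add_le[OF assms(1) False, of q] by simp
    qed
  qed
qed

lemma pat_extends:
  assumes "admissible d" "w \<in> codes d" "pat d w L" "L > 0"
  shows "extends L d"
proof -
  have "d q = of_bool (q < L)" if "q < N" for q
  proof (cases "q < L")
    case True
    then show ?thesis
      using pat_pos[OF assms(1-3) True] admissible_le_full[OF assms(1), of q] that
      by (simp add: full_less)
  next
    \<comment> \<open>For \<open>L < N\<close> the leading \<open>False\<close> gives
      \<open>d L < d (L - 1)\<close>, so \<open>d\<close> drops to \<open>0\<close> at
      \<open>L\<close> and stays there up to \<open>N\<close>, since \<open>full\<close> is constant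
      below \<open>N\<close>.\<close>
    case False
    then have LN: "L < N" using that by simp
    then have "\<not> N dvd L" using assms(4) by (auto dest: dvd_imp_le)
    moreover have "zeros d L > 0"
      using assms(2,3) codes_Cons_False by (fastforce simp: pat_def)
    moreover have "d (L - 1) \<le> 1"
      using admissible_le_full[OF assms(1), of "L - 1"] LN by (simp add: full_less)
    ultimately have "d L = 0" using assms(4) by (simp add: zeros_def)
    moreover have "full L = 1" "full q = 1" using LN that by (simp_all add: full_less)
    ultimately show ?thesis
      using admissible_grow[OF assms(1), of L q] False by simp
  qed
  then show ?thesis using assms(4) pat_pos[OF assms(1-3)] by (simp add: extends_def)
qed

lemma extends_drop_row:
  assumes "extends L d"
  shows "d (q + N) = drop_row L d q + of_bool (q + N < L)"
  using assms by (auto simp: extends_def drop_row_def Suc_le_eq)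

text \<open>The pattern supplies the slack needed where the indicator of the row jumps: the leading
  \<open>False\<close> at \<open>L\<close> covers the growth bound, the leading letters in the
  window cover the comparison over a distance of \<open>N\<close>.\<close>

lemma drop_row_admissible:
  assumes "admissible d" "w \<in> codes d" "pat d w L" "L > 0"
  shows "admissible (drop_row L d)"
  unfolding admissible_def
proof (intro conjI allI)
  note ext = pat_extends[OF assms]
  note row = extends_drop_row[OF ext]
  note nf = pat_not_full[OF assms(1-3)]
  let ?d = "drop_row L d"
  have N2: "full N = 2" using full_add[of 0] by (simp add: full_def)
  show "?d 0 \<le> 1"
  proof (cases "N < L")
    case True
    then show ?thesis using row[of 0] admissible_le_full[OF assms(1), of N] N2 by simp
  next
    case False
    then have "d N \<noteq> full N" using nf admissible_full_down[OF assms(1), of N L] by auto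
    then show ?thesis using row[of 0] admissible_le_full[OF assms(1), of N] N2 False by simp
  qed
  fix q
  have "d (Suc (q + N)) \<le> d (q + N) + of_bool (N dvd Suc (q + N))"
    using assms(1) by (simp add: admissible_def)
  then have *: "d (Suc q + N) \<le> d (q + N) + of_bool (N dvd Suc q)"
    using dvd_add_left_iff[of N N "Suc q"] by simp
  show "?d (Suc q) \<le> ?d q + of_bool (N dvd Suc q)"
  proof (cases "Suc q + N = L")
    case True
    have "zeros d L > 0"
      using assms(2,3) codes_Cons_False by (fastforce simp: pat_def)
    then have "d L < d (L - 1) + of_bool (N dvd L)" using assms(4) by (simp add: zeros_def)
    moreover have "N dvd L \<longleftrightarrow> N dvd Suc q" "L - 1 = q + N"
      using True dvd_add_left_iff[of N N "Suc q"] by auto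
    ultimately show ?thesis
      using row[of q] row[of "Suc q"] True by simp
  next
    case False
    then have "(q + N < L) = (Suc q + N < L)" by auto
    then show ?thesis using row[of q] row[of "Suc q"] * by simp
  qed
  let ?x = "q + N"
  have opt: "d (?x + N) \<le> d ?x \<or> d (?x + N) = full (?x + N)"
    using assms(1) by (simp add: admissible_def)
  have nfl: "d p \<noteq> full p" if "L \<le> p" for p
    using nf that admissible_full_down[OF assms(1), of p L] by auto
  show "?d (q + N) \<le> ?d q \<or> ?d (q + N) = full (q + N)"
  proof (cases "?x < L \<and> L \<le> ?x + N")
    \<comment> \<open>Only \<open>?x\<close> loses a cell here. A leading \<open>True\<close>
      provides a strict drop that compensates; if \<open>?x\<close> is full instead,
      \<open>lt\<close> bounds the new count at \<open>q + N\<close> by \<open>full q + 1\<close>,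
      so one of the alternatives holds.\<close>
    case True
    have lt: "d (?x + N) < full (?x + N)"
      using nfl[of "?x + N"] True admissible_le_full[OF assms(1), of "?x + N"] by simp
    have "leads d w ?x" using True assms(3) by (simp add: pat_def)
    then have "d ?x = full ?x \<or> d (?x + N) < d ?x"
      using codes_leads_Cons[OF assms(2)] by metis
    then show ?thesis
      using row[of q] row[of "q + N"] True lt by (auto simp: full_add)
  next
    case False
    then show ?thesis
      using row[of q] row[of "q + N"] opt nfl[of "?x + N"] N_pos by (auto simp: full_add)
  qed
qed

lemma zeros_drop_row:
  assumes "admissible d" "extends L d" "admissible (drop_row L d)"
  shows "zeros d (q + N) = zeros (drop_row L d) q + of_bool (q + N = L)"
proof -
  note row = extends_drop_row[OF assms(2)]
  have "d (q + N - 1) = (if q = 0 then 0 else drop_row L d (q - 1)) + of_bool (q + N \<le> L)"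
  proof (cases q)
    case 0
    then show ?thesis using assms(2) N_pos by (auto simp: extends_def)
  next
    case (Suc p)
    then show ?thesis using row[of p] by auto
  qed
  moreover have "of_bool (q + N \<le> L) = of_bool (q + N < L) + (of_bool (q + N = L) :: nat)"
    by auto
  ultimately show ?thesis
    using admissible_zeros[OF assms(1), of "q + N"] admissible_zeros[OF assms(3), of q]
      row[of q] N_pos by simp
qed

lemma ones_drop_row:
  assumes "extends L d" "\<not> (q + N < L \<and> L \<le> q + 2 * N)"
  shows "ones d (q + N) = ones (drop_row L d) q"
  using assms extends_drop_row[OF assms(1), of q] extends_drop_row[OF assms(1), of "q + N"]
  by (auto simp: ones_def)

text \<open>Writing \<open>Suc (ones ...)\<close> would be wrong where the shortened count rises
  over a distance of \<open>N\<close>: both exponents of \<open>True\<close> are then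
  \<open>0\<close>.\<close>

lemma ones_drop_row_window:
  assumes "extends L d" "q + N < L" "L \<le> q + 2 * N"
  shows "ones d (q + N) = Suc (drop_row L d q) - drop_row L d (q + N)"
  using assms extends_drop_row[OF assms(1), of q] extends_drop_row[OF assms(1), of "q + N"]
  by (auto simp: ones_def)

lemma codes_full:
  assumes "admissible d" "w \<in> codes d" "d q = full q"
  shows "w q = replicate (ones d q) True"
proof -
  have "w q \<in> words (ones d q) (zeros d q)" using assms(2) by (simp add: codes_def)
  then show ?thesis by (simp add: zeros_full[OF assms(1,3)])
qed

lemma strip_codes:
  assumes "admissible d" "w \<in> codes d" "pat d w L" "L > 0"
  shows "strip L w \<in> codes (drop_row L d)"
  unfolding codes_def
proof (intro CollectI allI)
  fix q
  note ext = pat_extends[OF assms]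
  note zrow = zeros_drop_row[OF assms(1) ext drop_row_admissible[OF assms], of q]
  have wx: "w (q + N) \<in> words (ones d (q + N)) (zeros d (q + N))"
    using assms(2) by (simp add: codes_def)
  let ?d = "drop_row L d"
  consider "q + N = L" | "q + N < L" "L \<le> q + 2 * N" | "q + N > L \<or> L > q + 2 * N"
    by linarith
  then show "strip L w q \<in> words (ones ?d q) (zeros ?d q)"
  proof cases
    case 1
    then obtain v where "w (q + N) = False # v" using assms(3) by (auto simp: pat_def)
    then show ?thesis
      using wx zrow 1 ones_drop_row[OF ext, of q] by (simp add: strip_def words_def)
  next
    case 2
    have "leads d w (q + N)" using assms(3) 2 by (simp add: pat_def)
    then consider "d (q + N) = full (q + N)" | v where "w (q + N) = True # v"
      by (auto simp: leads_def)
    then show ?thesis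
    proof cases
      case 1
      \<comment> \<open>\<open>tl\<close> of an empty word is empty, in agreement with the truncated
        \<open>- 1\<close>, so empty words at full weights are covered as well.\<close>
      have "strip L w q = replicate (ones d (q + N) - 1) True"
        using codes_full[OF assms(1,2) 1] 2 by (simp add: strip_def)
      moreover have "zeros ?d q = 0" using zrow zeros_full[OF assms(1) 1] by simp
      moreover have "ones d (q + N) - 1 = ones ?d q"
        using ones_drop_row_window[OF ext 2] by (simp add: ones_def)
      ultimately show ?thesis by simp
    next
      case (2 v)
      then show ?thesis
        using wx zrow ones_drop_row_window[OF ext \<open>q + N < L\<close> \<open>L \<le> q + 2 * N\<close>]
          \<open>q + N < L\<close> \<open>L \<le> q + 2 * N\<close>
        by (auto simp: strip_def words_def ones_def)
    qed
  next
    case 3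
    then have "strip L w q = w (q + N)" by (auto simp: strip_def)
    moreover have "ones d (q + N) = ones ?d q"
      by (rule ones_drop_row[OF ext]) (use 3 in auto)
    ultimately show ?thesis using wx zrow 3 N_pos by auto
  qed
qed

section \<open>Inversions and injectivity under row removal\<close>

lemma inversions_words_trivial:
  assumes "v \<in> words b z" "b = 0 \<or> z = 0"
  shows "inversions v = 0"
  using assms by auto

text \<open>The deleted letter \<open>False\<close> at \<open>L\<close> forms one inversion with
  each of the \<open>ones d L\<close> letters \<open>True\<close> after it; a deleted
  \<open>True\<close> forms none. The words below \<open>N\<close>, which \<open>strip\<close>
  discards, have no inversions.\<close>

lemma strip_inversions:
  assumes "admissible d" "w \<in> codes d" "pat d w L" "L > 0" "\<And>q. q \<ge> Q \<Longrightarrow> d q = 0"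
  shows "(\<Sum>q<Q. inversions (w q)) = (\<Sum>q<Q. inversions (strip L w q)) + ones d L"
proof -
  note ext = pat_extends[OF assms(1-4)]
  have triv: "inversions (w q) = 0" if "ones d q = 0 \<or> zeros d q = 0" for q
    by (rule inversions_words_trivial[OF _ that]) (use assms(2) in \<open>simp add: codes_def\<close>)
  have small: "inversions (w q) = 0" if "q < N" for q
  proof (cases "q < L")
    case True
    then have "d q = full q" using ext that by (simp add: extends_def full_less)
    then show ?thesis using triv zeros_full[OF assms(1)] by simp
  next
    case False
    then have "ones d q = 0" using ext that by (simp add: extends_def ones_def)
    then show ?thesis using triv by simp
  qed
  have onesL: "ones d L = 0" if "L < N \<or> L \<ge> Q + N"
    using ext that assms(5)[of L] by (auto simp: extends_def ones_def)
  have split: "inversions (w (q + N)) = inversions (strip L w q)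
      + (if q + N = L then ones d L else 0)" for q
  proof -
    consider "q + N = L" | "q + N < L" "L \<le> q + 2 * N" | "q + N > L \<or> L > q + 2 * N"
      by linarith
    then show ?thesis
    proof cases
      case 1
      then obtain v where v: "w (q + N) = False # v" using assms(3) by (auto simp: pat_def)
      have "w (q + N) \<in> words (ones d (q + N)) (zeros d (q + N))"
        using assms(2) by (simp add: codes_def)
      then show ?thesis using v 1 by (simp add: strip_def words_def)
    next
      case 2
      have "leads d w (q + N)" using assms(3) 2 by (simp add: pat_def)
      then consider "d (q + N) = full (q + N)" | v where "w (q + N) = True # v"
        by (auto simp: leads_def)
      then show ?thesis
        using 2 codes_full[OF assms(1,2), of "q + N"] by cases (auto simp: strip_def)
    next
      case 3
      then show ?thesis by (auto simp: strip_def)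
    qed
  qed
  \<comment> \<open>Words from \<open>Q\<close> on contain no \<open>True\<close>, so the range may
    be extended by \<open>N\<close>, which makes the two ranges match after the shift.\<close>
  have "(\<Sum>q<Q. inversions (w q)) = (\<Sum>q<Q + N. inversions (w q))"
    by (rule sum.mono_neutral_left) (use triv assms(5) in \<open>auto simp: ones_def\<close>)
  also have "\<dots> = (\<Sum>q<N. inversions (w q)) + (\<Sum>q<Q. inversions (w (q + N)))"
    by (induction Q) (auto simp: ac_simps)
  also have "(\<Sum>q<N. inversions (w q)) = 0" using small by simp
  also have "(\<Sum>q<Q. inversions (w (q + N))) = (\<Sum>q<Q. inversions (strip L w q))
      + (\<Sum>q<Q. if q + N = L then ones d L else 0)"
    unfolding split by (rule sum.distrib)
  also have "(\<Sum>q<Q. if q + N = L then ones d L else 0) = ones d L"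
  proof (cases "N \<le> L \<and> L < Q + N")
    case True
    then have "(\<Sum>q<Q. if q + N = L then ones d L else 0) = (\<Sum>q<Q. if q = L - N then ones d L else 0)"
      by (intro sum.cong) auto
    then show ?thesis using True by auto
  next
    case False
    then show ?thesis using onesL by (intro trans[OF sum.neutral]) auto
  qed
  finally show ?thesis by simp
qed

text \<open>The only obstruction to shifting a pattern at \<open>M > L\<close> back to \<open>M + N\<close> is a weight that becomes
  full when the row is removed and whose word is empty. Comparing growth rates from \<open>M + N\<close> on
  shows that \<open>d\<close> would then be full at \<open>M - 1 \<ge> L\<close>.\<close>

lemma strip_top:
  assumes "admissible d" "w \<in> codes d" "top_pat d w L" "L > 0"
    and "pat (drop_row L d) (strip L w) M"
  shows "M \<le> L"
proof (rule ccontr)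
  assume "\<not> M \<le> L"
  then have above: "L < M" by simp
  have pat: "pat d w L" using assms(3) by (simp add: top_pat_def)
  note ext = pat_extends[OF assms(1,2) pat assms(4)]
  note row = extends_drop_row[OF ext]
  note adm' = drop_row_admissible[OF assms(1,2) pat assms(4)]
  note cod' = strip_codes[OF assms(1,2) pat assms(4)]
  have nfl: "d p < full p" if "L \<le> p" for p
    using pat_not_full[OF assms(1,2) pat] that admissible_full_down[OF assms(1), of p L]
      admissible_le_full[OF assms(1), of p] by fastforce
  have mono: "d (p + N) \<le> d p" if "L \<le> p + N" for p
    using that nfl[of "p + N"] assms(1) by (auto simp: admissible_def)
  let ?d = "drop_row L d" and ?w = "strip L w"
  obtain v where v: "?w M = False # v" using assms(5) by (auto simp: pat_def)
  have wM: "w (M + N) = False # v" using v above by (simp add: strip_def)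
  have "leads d w q" if q: "q < M + N" "M + N \<le> q + N" for q
  proof (cases "q < N")
    \<comment> \<open>This case is contradictory: it forces \<open>L \<le> M - 1 < N\<close>, where
      \<open>d\<close> vanishes, while leading at \<open>M - 1\<close> forces
      \<open>d (M - 1) > 0\<close>.\<close>
    case True
    have "leads ?d ?w (M - 1)" using assms(5) above N_pos by (auto simp: pat_def)
    then have "?d (M - 1) > 0"
      using codes_leads_Cons[OF cod'] by (fastforce simp: full_def)
    then have "d (M - 1 + N) > 0" using row[of "M - 1"] by simp
    moreover have "L \<le> M - 1 + N" using above N_pos by simp
    ultimately have "d (M - 1) > 0" using mono[of "M - 1"] by linarith
    moreover have "d (M - 1) = 0" using ext True q above by (simp add: extends_def)
    ultimately show ?thesis by simp
  next
    case False
    define p where "p = q - N"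
    have p: "q = p + N" using False by (simp add: p_def)
    have wq: "?w p = w q" using p q above by (simp add: strip_def)
    have dq: "d q = ?d p" using row[of p] p q above by simp
    have lead: "leads ?d ?w p" using assms(5) q p by (simp add: pat_def)
    show ?thesis
    proof (cases "?d p = full p")
      case False
      then show ?thesis using lead wq by (simp add: leads_def)
    next
      case True
      then have rep: "w q = replicate (ones ?d p) True"
        using codes_full[OF adm' cod' True] wq by simp
      show ?thesis
      proof (cases "ones ?d p")
        case (Suc k)
        then show ?thesis using rep by (simp add: leads_def)
      next
        case 0
        then have "d q \<le> d (q + N)"
          using row[of p] row[of q] q above p by (simp add: ones_def)
        then have "d (M + N) + full (q + N) \<ge> d q + full (M + N)"
          using admissible_grow[OF assms(1), of "M + N" "q + N"] q by simp
        then have "d (M + N) + 1 \<ge> full M"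
          using dq True p by (simp add: full_add)
        moreover have "zeros d (M + N) > 0" using codes_Cons_False[OF assms(2) wM] .
        then have "d (M - 1 + N) + of_bool (N dvd M) > d (M + N)"
          using above by (auto simp: zeros_def)
        moreover have "full M = full (M - 1) + of_bool (N dvd M)"
          using full_Suc[of "M - 1"] above by simp
        ultimately have "d (M - 1 + N) \<ge> full (M - 1)" by simp
        moreover have "L \<le> M - 1 + N" using above N_pos by simp
        ultimately have "d (M - 1) \<ge> full (M - 1)" using mono[of "M - 1"] by linarith
        moreover have "L \<le> M - 1" using above by simp
        ultimately have False using nfl[of "M - 1"] by linarith
        then show ?thesis ..
      qed
    qed
  qed
  then have "pat d w (M + N)" using wM by (simp add: pat_def)
  then show False using assms(3) above by (auto simp: top_pat_def)
qed

text \<open>Deleted letters are prescribed by the pattern, and discarded words below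
  \<open>N\<close> by their letter counts. The one ambiguity of \<open>tl\<close>, an empty word,
  arises only at full weights, where the counts fix the word again.\<close>

lemma strip_inj:
  assumes "admissible d" "w \<in> codes d" "pat d w L" "L > 0"
    and "v \<in> codes d" "pat d v L" "strip L w = strip L v"
  shows "w = v"
proof
  fix q
  note ext = pat_extends[OF assms(1-4)]
  have triv: "w q = v q" if "ones d q = 0 \<or> zeros d q = 0"
  proof -
    have "w q \<in> words (ones d q) (zeros d q)" "v q \<in> words (ones d q) (zeros d q)"
      using assms(2,5) by (simp_all add: codes_def)
    with that show ?thesis by auto
  qed
  show "w q = v q"
  proof (cases "q < N")
    case True
    show ?thesis
    proof (cases "q < L")
      case True
      then have "d q = full q" using ext \<open>q < N\<close> by (simp add: extends_def full_less)
      then show ?thesis using triv zeros_full[OF assms(1)] by simp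
    next
      case False
      then show ?thesis using triv ext True by (simp add: extends_def ones_def)
    qed
  next
    case False
    define p where "p = q - N"
    have p: "q = p + N" using False by (simp add: p_def)
    have eq: "strip L w p = strip L v p" using assms(7) by simp
    consider "q = L" | "q < L" "L \<le> q + N" | "\<not> (q \<le> L \<and> L \<le> q + N)" by linarith
    then show ?thesis
    proof cases
      case 1
      then show ?thesis using eq p assms(3,6) by (auto simp: strip_def pat_def)
    next
      case 2
      have "leads d w q" "leads d v q" using assms(3,6) 2 by (simp_all add: pat_def)
      then show ?thesis
        using eq p 2 triv zeros_full[OF assms(1), of q] by (auto simp: strip_def leads_def)
    next
      case 3
      then show ?thesis using eq p by (auto simp: strip_def split: if_splits)
    qed
  qed
qed

text \<open>Inverse of \<open>strip L\<close>. Below \<open>N\<close> the word is unique whenever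
  \<open>extends L d\<close> holds, so the sorted form is no choice. The empty word occurs where the
  shortened count rises over a distance of \<open>N\<close>.\<close>

definition extend :: "nat \<Rightarrow> (nat \<Rightarrow> nat) \<Rightarrow> (nat \<Rightarrow> bool list) \<Rightarrow> nat \<Rightarrow> bool list" where
  "extend L d u q =
     (if q < N then replicate (ones d q) True @ replicate (zeros d q) False
      else if q = L then False # u (q - N)
      else if q < L \<and> L \<le> q + N then
        (if drop_row L d (q - N) < drop_row L d q then [] else True # u (q - N))
      else u (q - N))"

lemma replicate_append_words: "replicate b True @ replicate z False \<in> words b z"
  using words_0_left[of z] words_0_right[of b] by (auto simp: words_def)

text \<open>Maximality of \<open>L\<close>: a pattern at \<open>M\<close> with
  \<open>L < M \<le> L + N\<close> would need \<open>L\<close> to lead, against its initial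
  \<open>False\<close> and \<open>nfL\<close>; a pattern beyond \<open>L + N\<close> shifts to one
  of \<open>u\<close> at \<open>M - N > L\<close>, against \<open>le\<close>.\<close>

lemma extend_facts:
  assumes adm: "admissible d" and ext: "extends L d" and adm': "admissible (drop_row L d)"
    and u: "u \<in> codes (drop_row L d)" and nfL: "d L \<noteq> full L"
    and le: "\<And>M. pat (drop_row L d) u M \<Longrightarrow> M \<le> L"
  shows "extend L d u \<in> codes d" and "top_pat d (extend L d u) L"
    and "strip L (extend L d u) = u"
proof -
  let ?d = "drop_row L d" and ?w = "extend L d u"
  note row = extends_drop_row[OF ext]
  note zrow = zeros_drop_row[OF adm ext adm']
  have uq: "u q \<in> words (ones ?d q) (zeros ?d q)" for q using u by (simp add: codes_def)
  \<comment> \<open>A rise over a distance of \<open>N\<close> can only reach a full weight. Hence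
    the place \<open>q + N\<close> leads by being full, although its extended word is empty.\<close>
  have jump: "?d (q + N) = full q + 1 \<and> ?d q = full q \<and> zeros ?d q = 0
      \<and> d (q + N) = full (q + N)"
    if "?d q < ?d (q + N)" "q + N < L" for q
  proof -
    have 1: "?d (q + N) = full (q + N)"
      using adm' that by (meson admissible_def not_le)
    then have 2: "?d q = full q" using admissible_full_down[OF adm'] by simp
    then show ?thesis
      using 1 zeros_full[OF adm'] row[of q] that by (simp add: full_add)
  qed
  have L0: "L > 0" using ext by (simp add: extends_def)
  show cod: "?w \<in> codes d"
    unfolding codes_def
  proof (intro CollectI allI)
    fix x
    show "?w x \<in> words (ones d x) (zeros d x)"
    proof (cases "x < N")
      case True
      then show ?thesis by (simp add: extend_def replicate_append_words)
    next
      case False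
      define q where "q = x - N"
      have x: "x = q + N" using False by (simp add: q_def)
      consider "x = L" | "x < L" "L \<le> x + N" "?d q < ?d (q + N)"
        | "x < L" "L \<le> x + N" "?d q \<ge> ?d (q + N)" | "x > L \<or> L > x + N" by linarith
      then show ?thesis
      proof cases
        case 1
        then have "?w x = False # u q" using x by (auto simp: extend_def)
        moreover have "ones d x = ones ?d q" unfolding x
          by (rule ones_drop_row[OF ext]) (use 1 x in auto)
        ultimately show ?thesis using uq[of q] zrow[of q] x 1 by (simp add: words_def)
      next
        case 2
        then have "?w x = []" using x by (simp add: extend_def)
        moreover have "zeros d x = 0" using zrow[of q] jump[of q] 2 x by simp
        moreover have "ones d x = 0"
          using ones_drop_row_window[OF ext, of q] 2 x by simp
        ultimately show ?thesis by simp
      next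
        case 3
        then have "?w x = True # u q" using x by (simp add: extend_def)
        moreover have "zeros d x = zeros ?d q" using zrow[of q] 3 x by simp
        moreover have "ones d x = Suc (ones ?d q)"
          using ones_drop_row_window[OF ext, of q] 3 x by (simp add: ones_def)
        ultimately show ?thesis using uq[of q] by (simp add: words_def)
      next
        case 4
        then have "?w x = u q" using x by (auto simp: extend_def)
        moreover have "zeros d x = zeros ?d q" using zrow[of q] 4 x N_pos by auto
        moreover have "ones d x = ones ?d q" unfolding x
          by (rule ones_drop_row[OF ext]) (use 4 x in auto)
        ultimately show ?thesis using uq[of q] by simp
      qed
    qed
  qed
  have start: "\<exists>v. ?w L = False # v"
  proof (cases "L < N")
    case True
    then have "d L = 0" "d (L - 1) = 1" "ones d L = 0"
      using ext L0 by (auto simp: extends_def ones_def)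
    moreover have "\<not> N dvd L" using True L0 by (auto dest: dvd_imp_le)
    ultimately show ?thesis using True L0 by (simp add: extend_def zeros_def)
  next
    case False
    then show ?thesis by (simp add: extend_def)
  qed
  have "leads d ?w x" if x: "x < L" "L \<le> x + N" for x
  proof (cases "x < N")
    case True
    then have "d x = full x" using ext x by (simp add: extends_def full_less)
    then show ?thesis by (simp add: leads_def)
  next
    case False
    then show ?thesis using x jump[of "x - N"] by (auto simp: extend_def leads_def)
  qed
  then have pat: "pat d ?w L" using start by (simp add: pat_def)
  have nfl: "d p \<noteq> full p" if "L \<le> p" for p
    using nfL that admissible_full_down[OF adm, of p L] by auto
  have "M \<le> L" if M: "pat d ?w M" for M
  proof (rule ccontr)
    assume "\<not> M \<le> L"
    then have above: "L < M" by simp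
    show False
    proof (cases "M \<le> L + N")
      case True
      then have "leads d ?w L" using M above by (simp add: pat_def)
      then show False using start nfL by (auto simp: leads_def)
    next
      case False
      have shift: "?w (p + N) = u p" if "p + N > L" for p
        using that by (simp add: extend_def)
      have "leads ?d u q" if q: "q < M - N" "M - N \<le> q + N" for q
      proof -
        have "leads d ?w (q + N)" using M q False by (auto simp: pat_def)
        moreover have "q + N > L" using q False by simp
        ultimately show ?thesis using nfl[of "q + N"] shift by (simp add: leads_def)
      qed
      moreover have "\<exists>v. u (M - N) = False # v"
        using M shift[of "M - N"] False by (auto simp: pat_def)
      ultimately have "pat ?d u (M - N)" by (simp add: pat_def)
      from le[OF this] False show False by simp
    qed
  qed
  then show "top_pat d ?w L" using pat by (simp add: top_pat_def)
  show "strip L ?w = u"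
  proof
    fix q
    have "u q = []" if "?d q < ?d (q + N)" "q + N < L"
      using uq[of q] jump[OF that] that by (auto simp: ones_def)
    then show "strip L ?w q = u q" by (auto simp: strip_def extend_def)
  qed
qed

end

section \<open>Weight counts of partitions\<close>

definition part :: "nat list \<Rightarrow> nat \<Rightarrow> nat" where
  "part \<mu> i = (if i < length \<mu> then \<mu> ! i else 0)"

definition column :: "nat list \<Rightarrow> nat \<Rightarrow> nat" where
  "column \<mu> j = card {i. j < part \<mu> i}"

lemma part_Nil [simp]: "part [] i = 0"
  by (simp add: part_def)

lemma part_Cons_0 [simp]: "part (L # \<mu>) 0 = L"
  by (simp add: part_def)

lemma part_Cons_Suc [simp]: "part (L # \<mu>) (Suc i) = part \<mu> i"
  by (simp add: part_def)

lemma cells_part: "cells \<mu> = {(i, j). j < part \<mu> i}"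
  by (auto simp: cells_def part_def split: if_splits)

lemma Cons_partitions_iff:
  "L # \<mu> \<in> partitions \<longleftrightarrow> \<mu> \<in> partitions \<and> L > 0 \<and> part \<mu> 0 \<le> L"
  by (cases \<mu>) (auto simp: partitions_def)

lemma Nil_partitions [simp]: "[] \<in> partitions"
  by (simp add: partitions_def)

lemma part_Suc_le: "\<mu> \<in> partitions \<Longrightarrow> part \<mu> (Suc i) \<le> part \<mu> i"
proof (induction \<mu> arbitrary: i)
  case (Cons L \<mu>)
  then show ?case by (cases i) (auto simp: Cons_partitions_iff)
qed simp

lemma part_antimono: "\<mu> \<in> partitions \<Longrightarrow> i \<le> k \<Longrightarrow> part \<mu> k \<le> part \<mu> i"
  using lift_Suc_antimono_le[of "part \<mu>"] part_Suc_le by blast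

lemma finite_part: "finite {i. j < part \<mu> i}"
  by (rule finite_subset[of _ "{..<length \<mu>}"]) (auto simp: part_def split: if_splits)

lemma nat_set_Suc_decomp: "{i. P i} = (if P 0 then {0} else {}) \<union> Suc ` {i. P (Suc i)}"
  by (auto simp: image_iff) (metis not0_implies_Suc)+

lemma card_Suc_decomp:
  assumes "finite {i. P i}"
  shows "card {i. P i} = of_bool (P 0) + card {i. P (Suc i)}"
proof -
  have "finite (Suc ` {i. P (Suc i)})"
    using assms by (rule rev_finite_subset) auto
  then show ?thesis
    by (subst nat_set_Suc_decomp) (auto simp: card_image card_Un_disjoint)
qed

text \<open>Row lengths decrease weakly, so the rows meeting a column form an initial segment; this
  is conjugation of partitions.\<close>

lemma less_column_iff:
  assumes "\<mu> \<in> partitions"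
  shows "i < column \<mu> j \<longleftrightarrow> j < part \<mu> i"
proof -
  let ?S = "{i. j < part \<mu> i}"
  define n where "n = (LEAST i. i \<notin> ?S)"
  have "\<exists>i. i \<notin> ?S"
    using finite_part[of j \<mu>] infinite_UNIV_nat by (metis UNIV_eq_I)
  then have n: "n \<notin> ?S" unfolding n_def by (rule LeastI_ex)
  have lt: "i \<in> ?S" if "i < n" for i
    using not_less_Least[of i "\<lambda>i. i \<notin> ?S"] that unfolding n_def by blast
  have "i < n" if "i \<in> ?S" for i
    using n that part_antimono[OF assms, of n i] by (cases "i < n") auto
  with lt have "?S = {..<n}" by blast
  then have "column \<mu> j = n" by (simp add: column_def)
  then show ?thesis using \<open>?S = {..<n}\<close> by auto
qed

lemma arm_part: "arm \<mu> (i, j) = part \<mu> i - Suc j"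
proof -
  have "{w \<in> cells \<mu>. fst w = fst (i, j) \<and> snd w > snd (i, j)} = Pair i ` {j<..<part \<mu> i}"
    by (auto simp: cells_part)
  then show ?thesis by (simp add: arm_def card_image inj_on_def)
qed

lemma leg_part: "leg \<mu> (i, j) = card {k. i < k \<and> j < part \<mu> k}"
proof -
  have "{w \<in> cells \<mu>. snd w = snd (i, j) \<and> fst w > fst (i, j)}
      = (\<lambda>k. (k, j)) ` {k. i < k \<and> j < part \<mu> k}"
    by (auto simp: cells_part)
  then show ?thesis by (simp add: leg_def card_image inj_on_def)
qed

lemma leg_Cons_0: "leg (L # \<mu>) (0, j) = column \<mu> j"
proof -
  have "finite {k. 0 < k \<and> j < part (L # \<mu>) k}"
    by (rule finite_subset[OF _ finite_part[of j "L # \<mu>"]]) auto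
  from card_Suc_decomp[OF this] show ?thesis by (simp add: leg_part column_def)
qed

lemma leg_Cons_Suc: "leg (L # \<mu>) (Suc i, j) = leg \<mu> (i, j)"
proof -
  have "finite {k. Suc i < k \<and> j < part (L # \<mu>) k}"
    by (rule finite_subset[OF _ finite_part[of j "L # \<mu>"]]) auto
  from card_Suc_decomp[OF this] show ?thesis by (simp add: leg_part)
qed

lemma cells_Cons: "cells (L # \<mu>) = Pair 0 ` {..<L} \<union> (\<lambda>(i, j). (Suc i, j)) ` cells \<mu>"
proof -
  have "(i, j) \<in> cells (L # \<mu>) \<longleftrightarrow> (i, j) \<in> Pair 0 ` {..<L} \<union> (\<lambda>(i, j). (Suc i, j)) ` cells \<mu>"
    for i j by (cases i) (auto simp: cells_part image_iff)
  then show ?thesis by auto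
qed

lemma finite_cells: "finite (cells \<mu>)"
  by (induction \<mu>) (auto simp: cells_Cons, simp add: cells_part)

lemma psize_Cons: "psize (L # \<mu>) = L + psize \<mu>"
proof -
  have "inj (\<lambda>(i, j). (Suc i, j :: nat))" by (auto simp: inj_on_def)
  then show ?thesis
    unfolding psize_def cells_Cons
    by (subst card_Un_disjoint)
      (auto simp: card_image finite_cells inj_on_def intro!: card_image)
qed

lemma psize_Nil [simp]: "psize [] = 0"
  by (simp add: psize_def cells_part)

lemma finite_partitions_psize: "finite {\<mu> \<in> partitions. psize \<mu> = n}"
proof (rule finite_subset)
  have "length \<mu> \<le> psize \<mu> \<and> set \<mu> \<subseteq> {..psize \<mu>}" if "\<mu> \<in> partitions" for \<mu>
    using that by (induction \<mu>) (auto simp: psize_Cons Cons_partitions_iff)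
  then show "{\<mu> \<in> partitions. psize \<mu> = n} \<subseteq> {\<mu>. set \<mu> \<subseteq> {..n} \<and> length \<mu> \<le> n}"
    by auto
qed (rule finite_lists_length_le, simp)

section \<open>Counting the cells of a partition by weight\<close>

context weighted
begin

text \<open>Each row holds at most one cell of weight \<open>q\<close>, in column
  \<open>q - N * i\<close>, so counting rows counts cells.\<close>

definition diag :: "nat list \<Rightarrow> nat \<Rightarrow> nat" where
  "diag \<mu> q = card {i. N * i \<le> q \<and> q - N * i < part \<mu> i}"

lemma finite_mult_le: "finite {i. N * i \<le> q \<and> P i}"
proof (rule finite_subset)
  have "i \<le> q" if "N * i \<le> q" for i
    using N_pos that by (metis One_nat_def Suc_leI le_trans mult_le_mono1 nat_mult_1)
  then show "{i. N * i \<le> q \<and> P i} \<subseteq> {..q}" by auto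
qed simp

lemma diag_Nil: "diag [] = (\<lambda>q. 0)"
  by (simp add: diag_def fun_eq_iff)

lemma diag_Cons: "diag (L # \<mu>) q = of_bool (q < L) + (if q < N then 0 else diag \<mu> (q - N))"
proof -
  have "{i. N * Suc i \<le> q \<and> q - N * Suc i < part \<mu> i} =
      (if q < N then {} else {i. N * i \<le> q - N \<and> q - N - N * i < part \<mu> i})"
    by auto
  then show ?thesis
    using card_Suc_decomp[OF finite_mult_le[of q "\<lambda>i. q - N * i < part (L # \<mu>) i"]]
    by (simp add: diag_def)
qed

text \<open>Moving a cell one column to the left lowers its weight by one and fails only in column
  \<open>0\<close>, hence for at most one cell of each weight. A step of \<open>N\<close> uses the
  injection \<open>?f\<close>.\<close>

lemma diag_admissible:
  assumes "\<mu> \<in> partitions"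
  shows "admissible (diag \<mu>)"
  unfolding admissible_def
proof (intro conjI allI)
  let ?A = "\<lambda>q. {i. N * i \<le> q \<and> q - N * i < part \<mu> i}"
  have "?A 0 \<subseteq> {0}" using N_pos by auto
  from card_mono[OF _ this] show "diag \<mu> 0 \<le> 1" by (simp add: diag_def)
  fix q
  let ?new = "if N dvd Suc q then {Suc q div N} else {}"
  have "?A (Suc q) \<subseteq> ?A q \<union> ?new"
  proof
    fix i assume i: "i \<in> ?A (Suc q)"
    show "i \<in> ?A q \<union> ?new"
    proof (cases "N * i = Suc q")
      case True
      then show ?thesis using N_pos by (auto simp flip: True)
    qed (use i in auto)
  qed
  moreover have "finite (?A q)" by (rule finite_mult_le)
  ultimately have "card (?A (Suc q)) \<le> card (?A q \<union> ?new)" by (intro card_mono) auto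
  also have "\<dots> \<le> card (?A q) + card ?new" by (rule card_Un_le)
  finally show "diag \<mu> (Suc q) \<le> diag \<mu> q + of_bool (N dvd Suc q)"
    by (auto simp: diag_def split: if_splits)
  show "diag \<mu> (q + N) \<le> diag \<mu> q \<or> diag \<mu> (q + N) = full (q + N)"
  proof (cases "\<exists>k. N * k \<le> q + N \<and> k \<notin> ?A (q + N)")
    case True
    then obtain k where k: "N * k \<le> q + N" "k \<notin> ?A (q + N)" by blast
    \<comment> \<open>Row \<open>k\<close> has no cell of weight \<open>q + N\<close>. Cells in rows
      above it move \<open>N\<close> columns to the left, cells in rows below it move up one row;
      the gap at \<open>k\<close> makes this injective.\<close>
    let ?f = "\<lambda>i. if i < k then i else i - 1"
    have "inj_on ?f (?A (q + N))"
    proof (rule inj_onI)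
      fix x y assume "x \<in> ?A (q + N)" "y \<in> ?A (q + N)" "?f x = ?f y"
      moreover from this have "x \<noteq> k" "y \<noteq> k" using k(2) by blast+
      ultimately show "x = y" by (auto split: if_splits)
    qed
    moreover have "?f ` ?A (q + N) \<subseteq> ?A q"
    proof (intro image_subsetI)
      fix i assume i: "i \<in> ?A (q + N)"
      consider "i < k" | j where "i = Suc j" "i > k"
        using i k(2) by (metis (no_types, lifting) less_imp_Suc_add linorder_neqE_nat)
      then show "?f i \<in> ?A q"
      proof cases
        case 1
        then have "N * Suc i \<le> N * k" by (intro mult_le_mono) auto
        then show ?thesis using i k 1 by auto
      next
        case 2
        then show ?thesis using i part_Suc_le[OF assms, of j] by auto
      qed
    qed
    ultimately have "card (?A (q + N)) \<le> card (?A q)"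
      by (rule card_inj_on_le[OF _ _ finite_mult_le])
    then show ?thesis by (simp add: diag_def)
  next
    case False
    then have "?A (q + N) = {..(q + N) div N}"
      using N_pos less_eq_div_iff_mult_less_eq[of N _ "q + N"] by (auto simp: mult.commute[of N])
    then show ?thesis by (simp add: diag_def full_def)
  qed
qed

lemma diag_support:
  assumes "\<forall>q\<ge>Q. diag (L # \<mu>) q = 0"
  shows "L \<le> Q" "\<forall>q\<ge>Q - N. diag \<mu> q = 0"
proof -
  show "L \<le> Q" using assms[rule_format, of Q] by (auto simp: diag_Cons split: if_splits)
  have "diag \<mu> q = 0" if "q \<ge> Q - N" for q
    using assms[rule_format, of "q + N"] that by (simp add: diag_Cons)
  then show "\<forall>q\<ge>Q - N. diag \<mu> q = 0" by blast
qed

lemma diag_finite_support: "\<exists>Q. \<forall>q\<ge>Q. diag \<mu> q = 0"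
proof (induction \<mu>)
  case (Cons L \<mu>)
  then obtain Q where "\<forall>q\<ge>Q. diag \<mu> q = 0" by blast
  then have "\<forall>q\<ge>L + Q + N. diag (L # \<mu>) q = 0" by (simp add: diag_Cons)
  then show ?case by blast
qed (simp add: diag_Nil)

lemma psize_diag:
  assumes "\<forall>q\<ge>Q. diag \<mu> q = 0"
  shows "psize \<mu> = (\<Sum>q<Q. diag \<mu> q)"
  using assms
proof (induction \<mu> arbitrary: Q)
  case (Cons L \<mu>)
  note sup = diag_support[OF Cons.prems]
  have "{..<Q} \<inter> {q. q < L} = {..<L}" using sup(1) by auto
  then have "(\<Sum>q<Q. of_bool (q < L)) = L" by (simp add: sum_of_bool_eq)
  moreover have "(\<Sum>q<Q. if q < N then 0 else diag \<mu> (q - N)) = (\<Sum>q<Q - N. diag \<mu> q)"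
  proof (cases "N \<le> Q")
    case True
    have "(\<Sum>q<P + N. if q < N then 0 else diag \<mu> (q - N)) = (\<Sum>q<P. diag \<mu> q)" for P
      by (induction P) auto
    from this[of "Q - N"] show ?thesis using True by simp
  qed simp
  moreover have "psize \<mu> = (\<Sum>q<Q - N. diag \<mu> q)"
    by (rule Cons.IH[OF sup(2)])
  ultimately show ?case by (simp add: psize_Cons diag_Cons sum.distrib)
qed (simp add: diag_Nil)

lemma diag_Cons_extends:
  assumes "L # \<mu> \<in> partitions"
  shows "extends L (diag (L # \<mu>))" "drop_row L (diag (L # \<mu>)) = diag \<mu>"
  using assms by (auto simp: extends_def diag_Cons drop_row_def Cons_partitions_iff)

section \<open>The cells counted by \<open>h\<close> in the first row\<close>

lemma h_count_eq:
  "h_count N 1 \<mu> = card {(i, j). j < part \<mu> i \<and> N * leg \<mu> (i, j) = part \<mu> i - j}"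
proof -
  \<comment> \<open>The quotient is \<open>l\<close>, because \<open>a + 1 = N * l\<close> gives
    \<open>a + l + 1 = (N + 1) * l\<close>.\<close>
  have dvd: "(N + 1) dvd (a + l + 1)" if "N * l = 1 * (a + 1)" for a l
    by (rule dvdI[of _ _ l]) (use that in \<open>simp add: algebra_simps\<close>)
  have iff: "N * l = 1 * (p - Suc j + 1) \<and> (N + 1) dvd (p - Suc j + l + 1) \<longleftrightarrow> N * l = p - j"
    if "j < p" for l p j
    using dvd[of l "p - Suc j"] that by (auto simp: Suc_diff_Suc)
  have "(i, j) \<in> {v \<in> cells \<mu>. N * leg \<mu> v = 1 * (arm \<mu> v + 1) \<and> (N + 1) dvd (arm \<mu> v + leg \<mu> v + 1)}
      \<longleftrightarrow> (i, j) \<in> {(i, j). j < part \<mu> i \<and> N * leg \<mu> (i, j) = part \<mu> i - j}" for i j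
    using iff[of j "part \<mu> i" "leg \<mu> (i, j)"]
    by (simp only: cells_part arm_part mem_Collect_eq case_prod_conv) blast
  then show ?thesis unfolding h_count_def by (intro arg_cong[of _ _ card]) auto
qed

lemma h_count_Cons:
  "h_count N 1 (L # \<mu>) = h_count N 1 \<mu> + card {j. j < L \<and> N * column \<mu> j = L - j}"
proof -
  let ?H = "\<lambda>\<mu>. {(i, j). j < part \<mu> i \<and> N * leg \<mu> (i, j) = part \<mu> i - j}"
  let ?R = "{j. j < L \<and> N * column \<mu> j = L - j}"
  have "(i, j) \<in> ?H (L # \<mu>) \<longleftrightarrow> (i, j) \<in> (\<lambda>(i, j). (Suc i, j)) ` ?H \<mu> \<union> Pair 0 ` ?R" for i j
    by (cases i) (auto simp: leg_Cons_0 leg_Cons_Suc image_iff)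
  then have "?H (L # \<mu>) = (\<lambda>(i, j). (Suc i, j)) ` ?H \<mu> \<union> Pair 0 ` ?R" by auto
  moreover have "finite (?H \<mu>)"
    by (rule finite_subset[OF _ finite_cells[of \<mu>]]) (auto simp: cells_part)
  moreover have "inj (\<lambda>(i, j). (Suc i, j :: nat))" by (auto simp: inj_on_def)
  moreover have "finite ?R" by simp
  ultimately have "card (?H (L # \<mu>)) = card ((\<lambda>(i, j). (Suc i, j)) ` ?H \<mu>) + card (Pair (0 :: nat) ` ?R)"
    by (simp only:) (rule card_Un_disjoint, auto)
  then show ?thesis
    unfolding h_count_eq
    by (simp add: card_image inj_on_subset[OF \<open>inj (\<lambda>(i, j). (Suc i, j :: nat))\<close>] inj_on_def[of "Pair 0"])
qed

lemma h_count_Nil: "h_count N 1 [] = 0"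
  unfolding h_count_eq by simp

text \<open>The condition on a cell \<open>(0, j)\<close> says that the bottom cell of its column
  has weight \<open>L\<close>. Cells of weight \<open>L + N\<close> lie directly below cells of
  weight \<open>L\<close>, so subtracting their number leaves the columns that end at weight
  \<open>L\<close>.\<close>

lemma card_first_row:
  assumes "L # \<mu> \<in> partitions"
  shows "card {j. j < L \<and> N * column \<mu> j = L - j} = ones (diag (L # \<mu>)) L"
proof -
  have mu: "\<mu> \<in> partitions" "L > 0" "part \<mu> 0 \<le> L"
    using assms by (auto simp: Cons_partitions_iff)
  \<comment> \<open>Row \<open>k\<close> of \<open>\<mu>\<close> is row \<open>Suc k\<close> of the
    whole partition. \<open>?J\<close> lists the rows with a cell of weight \<open>L\<close>,
    \<open>?J'\<close> those where the cell below it is present too.\<close>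
  let ?J = "{k. N * Suc k \<le> L \<and> L - N * Suc k < part \<mu> k}"
  let ?J' = "{k. N * Suc k \<le> L \<and> L - N * Suc k < part \<mu> (Suc k)}"
  have J: "diag (L # \<mu>) L = card ?J"
  proof -
    have "?J = (if L < N then {} else {i. N * i \<le> L - N \<and> L - N - N * i < part \<mu> i})" by auto
    then show ?thesis unfolding diag_Cons by (simp add: diag_def)
  qed
  have J': "diag (L # \<mu>) (L + N) = card ?J'"
    using card_Suc_decomp[OF finite_mult_le[of L "\<lambda>i. L - N * i < part \<mu> i"]] mu(3)
    unfolding diag_Cons by (simp add: diag_def)
  have fin: "finite ?J'"
    by (rule finite_subset[OF _ finite_mult_le[of L "\<lambda>_. True"]]) auto
  have sub: "?J' \<subseteq> ?J" using part_Suc_le[OF mu(1)] by (auto intro: less_le_trans)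
  have col: "column \<mu> j = Suc k \<longleftrightarrow> j < part \<mu> k \<and> \<not> j < part \<mu> (Suc k)" for j k
    by (simp flip: less_column_iff[OF mu(1)]) auto
  have "ones (diag (L # \<mu>)) L = card (?J - ?J')"
    unfolding ones_def J J' by (rule card_Diff_subset[OF fin sub, symmetric])
  also have "?J - ?J' = {k. N * Suc k \<le> L \<and> column \<mu> (L - N * Suc k) = Suc k}"
    using col by auto
  also have "card \<dots> = card {j. j < L \<and> N * column \<mu> j = L - j}"
  proof (rule bij_betw_same_card[of "\<lambda>k. L - N * Suc k"], rule bij_betw_byWitness[of _ "\<lambda>j. column \<mu> j - 1"])
    show "\<forall>j\<in>{j. j < L \<and> N * column \<mu> j = L - j}. L - N * Suc (column \<mu> j - 1) = j"
    proof
      fix j assume j: "j \<in> {j. j < L \<and> N * column \<mu> j = L - j}"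
      then obtain k where k: "column \<mu> j = Suc k" by (cases "column \<mu> j") auto
      then have "N * Suc k = L - j" using j by auto
      then show "L - N * Suc (column \<mu> j - 1) = j" using j k by (simp del: mult_Suc_right)
    qed
    show "(\<lambda>j. column \<mu> j - 1) ` {j. j < L \<and> N * column \<mu> j = L - j}
        \<subseteq> {k. N * Suc k \<le> L \<and> column \<mu> (L - N * Suc k) = Suc k}"
    proof (intro image_subsetI)
      fix j assume j: "j \<in> {j. j < L \<and> N * column \<mu> j = L - j}"
      then obtain k where k: "column \<mu> j = Suc k" by (cases "column \<mu> j") auto
      then have "N * Suc k = L - j" using j by auto
      then show "column \<mu> j - 1 \<in> {k. N * Suc k \<le> L \<and> column \<mu> (L - N * Suc k) = Suc k}"
        using j k by (simp del: mult_Suc_right)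
    qed
    show "(\<lambda>k. L - N * Suc k) ` {k. N * Suc k \<le> L \<and> column \<mu> (L - N * Suc k) = Suc k}
        \<subseteq> {j. j < L \<and> N * column \<mu> j = L - j}"
      using N_pos mu(2) by auto
  qed auto
  finally show ?thesis by simp
qed

lemma h_count_Cons_diag:
  "L # \<mu> \<in> partitions \<Longrightarrow> h_count N 1 (L # \<mu>) = h_count N 1 \<mu> + ones (diag (L # \<mu>)) L"
  by (simp only: h_count_Cons card_first_row)

end

section \<open>The sum over partitions with given weight counts\<close>

lemma monom_sum: "monom (1::int) (\<Sum>q\<in>A. f q) = (\<Prod>q\<in>A. monom 1 (f q))"
proof (induction A rule: infinite_finite_induct)
  case (insert x A)
  then show ?case by (simp add: mult_monom flip: insert.IH)
qed (simp_all add: monom_eq_1)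

section \<open>Codes and partitions with a fixed weight count\<close>

context weighted
begin

text \<open>From \<open>Q\<close> on the words are forced, and below \<open>Q\<close> they vary
  independently, so the sum factors.\<close>

lemma sum_codes:
  assumes "\<forall>q\<ge>Q. d q = 0"
  shows "(\<Sum>w\<in>codes d. monom 1 (\<Sum>q<Q. inversions (w q)))
       = (\<Prod>q<Q. gauss_binomial (int (ones d q + zeros d q)) (int (ones d q)))"
proof -
  let ?W = "\<lambda>q. words (ones d q) (zeros d q)"
  have tail: "ones d q = 0" if "q \<ge> Q" for q using assms that by (simp add: ones_def)
  have "(\<Sum>w\<in>codes d. monom (1::int) (\<Sum>q<Q. inversions (w q)))
      = (\<Sum>g\<in>PiE {..<Q} ?W. \<Prod>q<Q. monom 1 (inversions (g q)))"
  proof (rule sum.reindex_bij_witness[of _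
        "\<lambda>g q. if q < Q then g q else replicate (zeros d q) False" "\<lambda>w. restrict w {..<Q}"])
    fix w assume w: "w \<in> codes d"
    then have "w q \<in> ?W q" for q by (simp add: codes_def)
    then have "w q = replicate (zeros d q) False" if "q \<ge> Q" for q
      using that tail[OF that] by (metis singletonD words_0_left)
    then show "(\<lambda>q. if q < Q then restrict w {..<Q} q else replicate (zeros d q) False) = w"
      by (auto simp: fun_eq_iff)
    show "restrict w {..<Q} \<in> PiE {..<Q} ?W" using w by (auto simp: codes_def)
    show "(\<Prod>q<Q. monom (1::int) (inversions (restrict w {..<Q} q))) = monom 1 (\<Sum>q<Q. inversions (w q))"
      by (simp add: monom_sum)
  next
    fix g assume g: "g \<in> PiE {..<Q} ?W"
    show "restrict (\<lambda>q. if q < Q then g q else replicate (zeros d q) False) {..<Q} = g"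
      using g by (auto simp: fun_eq_iff PiE_def extensional_def restrict_def)
    show "(\<lambda>q. if q < Q then g q else replicate (zeros d q) False) \<in> codes d"
      using g tail by (auto simp: codes_def PiE_def Pi_def not_less)
  qed
  also have "\<dots> = (\<Prod>q<Q. \<Sum>ws\<in>?W q. monom 1 (inversions ws))"
    by (rule prod_sum_PiE[symmetric]) auto
  finally show ?thesis by (simp add: sum_words)
qed

lemma finite_codes:
  assumes "\<forall>q\<ge>Q. d q = 0"
  shows "finite (codes d)"
proof (rule inj_on_finite)
  let ?W = "\<lambda>q. words (ones d q) (zeros d q)"
  show "(\<lambda>w. restrict w {..<Q}) ` codes d \<subseteq> PiE {..<Q} ?W"
    by (auto simp: codes_def PiE_def extensional_def)
  show "inj_on (\<lambda>w. restrict w {..<Q}) (codes d)"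
  proof (rule inj_onI, rule ext)
    fix w v q assume *: "w \<in> codes d" "v \<in> codes d" "restrict w {..<Q} = restrict v {..<Q}"
    show "w q = v q"
    proof (cases "q < Q")
      case True
      then show ?thesis using fun_cong[OF *(3), of q] by simp
    next
      case False
      then have "ones d q = 0" using assms by (simp add: ones_def)
      moreover have "w q \<in> ?W q" "v q \<in> ?W q" using * by (auto simp: codes_def)
      ultimately show ?thesis by simp
    qed
  qed
qed (auto intro: finite_PiE)

lemma codes_nonempty: "codes d \<noteq> {}"
proof -
  have "(\<lambda>q. replicate (ones d q) True @ replicate (zeros d q) False) \<in> codes d"
    by (simp add: codes_def replicate_append_words)
  then show ?thesis by blast
qed

definition fibre :: "(nat \<Rightarrow> nat) \<Rightarrow> nat list set" where
  "fibre d = {\<mu> \<in> partitions. diag \<mu> = d}"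

lemma finite_fibre:
  assumes "\<forall>q\<ge>Q. d q = 0"
  shows "finite (fibre d)"
proof (rule finite_subset[OF _ finite_partitions_psize])
  show "fibre d \<subseteq> {\<mu> \<in> partitions. psize \<mu> = (\<Sum>q<Q. d q)}"
    using psize_diag[of Q] assms by (auto simp: fibre_def)
qed

lemma diag_Cons_not_full:
  assumes "L # \<mu> \<in> partitions"
  shows "diag (L # \<mu>) L \<noteq> full L"
proof (cases "L < N")
  case True
  then show ?thesis by (simp add: diag_Cons full_def)
next
  case False
  have "admissible (diag \<mu>)" using assms by (simp add: diag_admissible Cons_partitions_iff)
  from admissible_le_full[OF this, of "L - N"] show ?thesis
    using False full_add[of "L - N"] by (simp add: diag_Cons)
qed

text \<open>Start of the recursion: the empty partition matches the unique code of the zero count.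
  For any other \<open>d\<close> both index sets are empty, as a pattern at \<open>0\<close> would
  force \<open>d 0 = 0\<close>.\<close>

lemma row_zero:
  assumes "admissible d" "\<forall>q\<ge>Q. d q = 0"
  shows "(\<Sum>\<mu> | \<mu> \<in> fibre d \<and> part \<mu> 0 = 0. monom (1::int) (h_count N 1 \<mu>))
       = (\<Sum>w | w \<in> codes d \<and> top_pat d w 0. monom 1 (\<Sum>q<Q. inversions (w q)))"
proof (cases "d = (\<lambda>q. 0)")
  case True
  have "part \<mu> 0 = 0 \<longleftrightarrow> \<mu> = []" if "\<mu> \<in> partitions" for \<mu>
    using that by (cases \<mu>) (auto simp: Cons_partitions_iff)
  then have *: "{\<mu>. \<mu> \<in> fibre d \<and> part \<mu> 0 = 0} = {[]}"
    using True by (auto simp: fibre_def diag_Nil)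
  have ones: "ones d q = 0" for q using True by (simp add: ones_def)
  have "codes d = {\<lambda>q. replicate (zeros d q) False}"
    by (auto simp: codes_def ones fun_eq_iff)
  moreover have "top_pat d (\<lambda>q. replicate (zeros d q) False) 0"
    using top_pat_exists[OF assms(1), of "\<lambda>q. replicate (zeros d q) False" 0] calculation True by auto
  ultimately have "{w. w \<in> codes d \<and> top_pat d w 0} = {\<lambda>q. replicate (zeros d q) False}" by auto
  then show ?thesis using * by (simp only: h_count_Nil) (simp add: h_count_Nil[simplified])
next
  case False
  have "part \<mu> 0 \<noteq> 0" if "\<mu> \<in> fibre d" for \<mu>
    using that False by (cases \<mu>) (auto simp: fibre_def Cons_partitions_iff diag_Nil)
  moreover have "\<not> top_pat d w 0" if "w \<in> codes d" for w
  proof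
    assume "top_pat d w 0"
    then have "d 0 \<noteq> full 0" using pat_not_full[OF assms(1) that] by (simp add: top_pat_def)
    then have "d 0 = 0" using admissible_le_full[OF assms(1), of 0] by (simp add: full_def)
    with admissible_eq_0[OF assms(1)] False show False by auto
  qed
  ultimately have "{\<mu>. \<mu> \<in> fibre d \<and> part \<mu> 0 = 0} = {}" "{w. w \<in> codes d \<and> top_pat d w 0} = {}"
    by auto
  then show ?thesis by (simp only: sum.empty)
qed

text \<open>Removing a row of length \<open>L\<close> splits off the same factor
  \<open>monom 1 (ones d L)\<close> on both sides, by \<open>h_count_Cons_diag\<close> and
  \<open>strip_inversions\<close>.\<close>

lemma row_step:
  assumes adm: "admissible d" and sup: "\<forall>q\<ge>Q. d q = 0" and L: "L > 0"
    and IH: "\<lbrakk>extends L d; admissible (drop_row L d)\<rbrakk> \<Longrightarrow>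
      (\<Sum>\<mu> | \<mu> \<in> fibre (drop_row L d) \<and> part \<mu> 0 \<le> L. monom (1::int) (h_count N 1 \<mu>))
      = (\<Sum>w | w \<in> codes (drop_row L d) \<and> (\<forall>M. pat (drop_row L d) w M \<longrightarrow> M \<le> L).
            monom 1 (\<Sum>q<Q. inversions (w q)))"
  shows "(\<Sum>\<mu> | \<mu> \<in> fibre d \<and> part \<mu> 0 = L. monom (1::int) (h_count N 1 \<mu>))
       = (\<Sum>w | w \<in> codes d \<and> top_pat d w L. monom 1 (\<Sum>q<Q. inversions (w q)))"
proof (cases "extends L d \<and> admissible (drop_row L d) \<and> d L \<noteq> full L")
  case True
  let ?d = "drop_row L d"
  let ?P = "{\<mu>. \<mu> \<in> fibre ?d \<and> part \<mu> 0 \<le> L}" and ?P' = "{\<mu>. \<mu> \<in> fibre d \<and> part \<mu> 0 = L}"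
  let ?C = "{w. w \<in> codes ?d \<and> (\<forall>M. pat ?d w M \<longrightarrow> M \<le> L)}"
  let ?C' = "{w. w \<in> codes d \<and> top_pat d w L}"
  have P': "?P' = (#) L ` ?P"
  proof (intro set_eqI iffI)
    fix \<mu> assume \<mu>: "\<mu> \<in> ?P'"
    then obtain \<nu> where "\<mu> = L # \<nu>" using L by (cases \<mu>) auto
    then show "\<mu> \<in> (#) L ` ?P"
      using \<mu> diag_Cons_extends(2)[of L \<nu>] by (auto simp: fibre_def Cons_partitions_iff)
  next
    fix \<mu> assume "\<mu> \<in> (#) L ` ?P"
    then obtain \<nu> where \<nu>: "\<mu> = L # \<nu>" "\<nu> \<in> partitions" "diag \<nu> = ?d" "part \<nu> 0 \<le> L"
      by (auto simp: fibre_def)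
    have "diag (L # \<nu>) q = d q" for q
      using True extends_drop_row[of L d "q - N"] \<nu>(3) by (auto simp: diag_Cons extends_def)
    then show "\<mu> \<in> ?P'" using \<nu> L by (auto simp: fibre_def Cons_partitions_iff)
  qed
  have "bij_betw (strip L) ?C' ?C"
    unfolding bij_betw_def
  proof
    show "inj_on (strip L) ?C'"
      using strip_inj[OF adm _ _ L] by (auto simp: inj_on_def top_pat_def)
    show "strip L ` ?C' = ?C"
    proof (intro set_eqI iffI)
      fix u assume "u \<in> strip L ` ?C'"
      then show "u \<in> ?C"
        using strip_codes[OF adm _ _ L] strip_top[OF adm _ _ L] by (auto simp: top_pat_def)
    next
      fix u assume "u \<in> ?C"
      then show "u \<in> strip L ` ?C'"
        using extend_facts[of d L u] adm True by (intro image_eqI[of _ _ "extend L d u"]) auto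
    qed
  qed
  then have "(\<Sum>w\<in>?C. monom (1::int) ((\<Sum>q<Q. inversions (w q)) + ones d L))
      = (\<Sum>w\<in>?C'. monom 1 ((\<Sum>q<Q. inversions (strip L w q)) + ones d L))"
    by (rule sum.reindex_bij_betw[symmetric])
  also have "\<dots> = (\<Sum>w\<in>?C'. monom 1 (\<Sum>q<Q. inversions (w q)))"
    using strip_inversions[OF adm _ _ L, of _ Q] sup by (intro sum.cong) (auto simp: top_pat_def)
  finally have C: "(\<Sum>w\<in>?C'. monom (1::int) (\<Sum>q<Q. inversions (w q)))
      = (\<Sum>w\<in>?C. monom 1 (\<Sum>q<Q. inversions (w q))) * monom 1 (ones d L)"
    by (simp add: sum_distrib_right mult_monom)
  have "(\<Sum>\<mu>\<in>?P'. monom (1::int) (h_count N 1 \<mu>)) = (\<Sum>\<mu>\<in>?P. monom 1 (h_count N 1 (L # \<mu>)))"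
    unfolding P' by (subst sum.reindex) auto
  also have "\<dots> = (\<Sum>\<mu>\<in>?P. monom 1 (h_count N 1 \<mu>) * monom 1 (ones d L))"
  proof (rule sum.cong)
    fix \<mu> assume "\<mu> \<in> ?P"
    then have "L # \<mu> \<in> ?P'" using P' by blast
    then have "h_count N 1 (L # \<mu>) = h_count N 1 \<mu> + ones d L"
      using h_count_Cons_diag[of L \<mu>] by (simp add: fibre_def)
    then show "monom (1::int) (h_count N 1 (L # \<mu>)) = monom 1 (h_count N 1 \<mu>) * monom 1 (ones d L)"
      by (simp only: mult_monom mult_1)
  qed simp
  also have "\<dots> = (\<Sum>\<mu>\<in>?P. monom 1 (h_count N 1 \<mu>)) * monom 1 (ones d L)"
    by (rule sum_distrib_right[symmetric])
  also have "(\<Sum>\<mu>\<in>?P. monom (1::int) (h_count N 1 \<mu>))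
      = (\<Sum>w\<in>?C. monom 1 (\<Sum>q<Q. inversions (w q)))"
    using True by (intro IH) auto
  finally show ?thesis using C by (simp only:)
next
  \<comment> \<open>No partition with counts \<open>d\<close> has first row \<open>L\<close>, and no
    code has top pattern \<open>L\<close>, so both sums are empty.\<close>
  case False
  have "part \<mu> 0 \<noteq> L" if "\<mu> \<in> fibre d" for \<mu>
  proof
    assume "part \<mu> 0 = L"
    then obtain \<nu> where "\<mu> = L # \<nu>" using L by (cases \<mu>) auto
    then show False
      using that False diag_Cons_extends[of L \<nu>] diag_Cons_not_full[of L \<nu>] diag_admissible[of \<nu>]
      by (auto simp: fibre_def Cons_partitions_iff)
  qed
  moreover have "\<not> top_pat d w L" if "w \<in> codes d" for w
    using False pat_extends[OF adm that _ L] drop_row_admissible[OF adm that _ L]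
      pat_not_full[OF adm that] by (auto simp: top_pat_def)
  ultimately have "{\<mu>. \<mu> \<in> fibre d \<and> part \<mu> 0 = L} = {}" "{w. w \<in> codes d \<and> top_pat d w L} = {}"
    by auto
  then show ?thesis by (simp only: sum.empty)
qed

text \<open>The bound \<open>L\<close> is carried through the induction because the next row may not
  exceed the one just removed. It corresponds to the absence of patterns beyond
  \<open>L\<close>.\<close>

lemma fibre_codes_le:
  assumes "admissible d" "\<forall>q\<ge>Q. d q = 0"
  shows "(\<Sum>\<mu> | \<mu> \<in> fibre d \<and> part \<mu> 0 \<le> L. monom (1::int) (h_count N 1 \<mu>))
       = (\<Sum>w | w \<in> codes d \<and> (\<forall>M. pat d w M \<longrightarrow> M \<le> L). monom 1 (\<Sum>q<Q. inversions (w q)))"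
  using assms
proof (induction "\<Sum>q<Q. d q" arbitrary: d L rule: less_induct)
  case less
  note adm = less.prems(1) and sup = less.prems(2)
  have row: "(\<Sum>\<mu> | \<mu> \<in> fibre d \<and> part \<mu> 0 = l. monom (1::int) (h_count N 1 \<mu>))
       = (\<Sum>w | w \<in> codes d \<and> top_pat d w l. monom 1 (\<Sum>q<Q. inversions (w q)))" for l
  proof (cases "l = 0")
    case True
    then show ?thesis using row_zero[OF adm sup] by simp
  next
    case False
    show ?thesis
    proof (rule row_step[OF adm sup])
      assume ext: "extends l d" and adm': "admissible (drop_row l d)"
      have "(\<Sum>q<N + Q. d q) = (\<Sum>q<N. d q) + (\<Sum>q<Q. d (q + N))"
        by (induction Q) (auto simp: ac_simps)
      moreover have "(\<Sum>q<Q. d q) = (\<Sum>q<N + Q. d q)"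
        by (rule sum.mono_neutral_left) (use sup in auto)
      moreover have "(\<Sum>q<Q. drop_row l d q) \<le> (\<Sum>q<Q. d (q + N))"
        by (intro sum_mono) (simp add: drop_row_def)
      \<comment> \<open>The measure decreases because the counts discarded below \<open>N\<close>
        are not all zero.\<close>
      moreover have "d 0 > 0" using ext by (simp add: extends_def)
      then have "(\<Sum>q<N. d q) > 0" using N_pos by (intro sum_pos2[of _ 0]) auto
      ultimately have "(\<Sum>q<Q. drop_row l d q) < (\<Sum>q<Q. d q)" by linarith
      moreover have "\<forall>q\<ge>Q. drop_row l d q = 0" using sup by (simp add: drop_row_def)
      ultimately show "(\<Sum>\<mu> | \<mu> \<in> fibre (drop_row l d) \<and> part \<mu> 0 \<le> l. monom (1::int) (h_count N 1 \<mu>))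
        = (\<Sum>w | w \<in> codes (drop_row l d) \<and> (\<forall>M. pat (drop_row l d) w M \<longrightarrow> M \<le> l).
            monom 1 (\<Sum>q<Q. inversions (w q)))"
        using less.hyps[of "drop_row l d" l] adm' by blast
    qed (use False in simp)
  qed
  have "{\<mu>. \<mu> \<in> fibre d \<and> part \<mu> 0 \<le> L} = (\<Union>l\<le>L. {\<mu>. \<mu> \<in> fibre d \<and> part \<mu> 0 = l})" by auto
  moreover have "{w. w \<in> codes d \<and> (\<forall>M. pat d w M \<longrightarrow> M \<le> L)} = (\<Union>l\<le>L. {w. w \<in> codes d \<and> top_pat d w l})"
  proof (intro set_eqI iffI)
    fix w assume w: "w \<in> {w. w \<in> codes d \<and> (\<forall>M. pat d w M \<longrightarrow> M \<le> L)}"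
    then obtain l where "top_pat d w l" using top_pat_exists[OF adm, of w Q] sup by blast
    then show "w \<in> (\<Union>l\<le>L. {w. w \<in> codes d \<and> top_pat d w l})" using w by (auto simp: top_pat_def)
  next
    fix w assume "w \<in> (\<Union>l\<le>L. {w. w \<in> codes d \<and> top_pat d w l})"
    then show "w \<in> {w. w \<in> codes d \<and> (\<forall>M. pat d w M \<longrightarrow> M \<le> L)}"
      by (auto simp: top_pat_def intro: order_trans)
  qed
  moreover have "(\<Sum>\<mu>\<in>(\<Union>l\<le>L. {\<mu>. \<mu> \<in> fibre d \<and> part \<mu> 0 = l}). monom (1::int) (h_count N 1 \<mu>))
      = (\<Sum>l\<le>L. \<Sum>\<mu> | \<mu> \<in> fibre d \<and> part \<mu> 0 = l. monom (1::int) (h_count N 1 \<mu>))"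
    by (rule sum.UNION_disjoint) (use finite_fibre[OF sup] in auto)
  moreover have "(\<Sum>w\<in>(\<Union>l\<le>L. {w. w \<in> codes d \<and> top_pat d w l}). monom (1::int) (\<Sum>q<Q. inversions (w q)))
      = (\<Sum>l\<le>L. \<Sum>w | w \<in> codes d \<and> top_pat d w l. monom 1 (\<Sum>q<Q. inversions (w q)))"
    by (rule sum.UNION_disjoint) (use finite_codes[OF sup] top_pat_unique in auto)
  ultimately show ?case using row by (simp only:)
qed

lemma sum_fibre_codes:
  assumes "admissible d" "\<forall>q\<ge>Q. d q = 0"
  shows "(\<Sum>\<mu>\<in>fibre d. monom (1::int) (h_count N 1 \<mu>))
       = (\<Sum>w\<in>codes d. monom 1 (\<Sum>q<Q. inversions (w q)))"
proof -
  have "part \<mu> 0 \<le> Q" if "\<mu> \<in> fibre d" for \<mu>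
    using that diag_support(1)[of Q] assms(2) by (cases \<mu>) (auto simp: fibre_def)
  then have "{\<mu>. \<mu> \<in> fibre d \<and> part \<mu> 0 \<le> Q} = fibre d" by auto
  moreover have "{w. w \<in> codes d \<and> (\<forall>M. pat d w M \<longrightarrow> M \<le> Q)} = codes d"
    using pat_bound[of _ d Q] assms(2) by auto
  ultimately show ?thesis using fibre_codes_le[OF assms, of Q] by (simp only:)
qed

text \<open>Evaluating the identity at \<open>1\<close> shows that there are as many partitions as
  codes, and at least one code exists.\<close>

lemma fibre_nonempty:
  assumes "admissible d" "\<forall>q\<ge>Q. d q = 0"
  shows "fibre d \<noteq> {}"
proof
  assume "fibre d = {}"
  then have "(\<Sum>w\<in>codes d. monom (1::int) (\<Sum>q<Q. inversions (w q))) = 0"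
    using sum_fibre_codes[OF assms] by simp
  then have "poly (\<Sum>w\<in>codes d. monom (1::int) (\<Sum>q<Q. inversions (w q))) 1 = 0" by simp
  then have "card (codes d) = 0" by (simp add: poly_sum poly_monom)
  then show False using finite_codes[OF assms(2)] codes_nonempty by simp
qed

end

section \<open>Sequences and weight counts\<close>

text \<open>Each power of \<open>fps_X\<close> receives only finitely many terms, which gives
  convergence coefficient by coefficient.\<close>

lemma has_sum_fps_graded:
  fixes c :: "'a \<Rightarrow> 'b :: comm_ring_1"
  assumes "\<And>n. finite {x \<in> A. e x = n}"
  shows "((\<lambda>x. fps_const (c x) * fps_X ^ e x) has_sum Abs_fps (\<lambda>n. \<Sum>x | x \<in> A \<and> e x = n. c x)) A"
proof (rule has_sum_fpsI)
  fix n
  have nth: "fps_nth (fps_const (c x) * fps_X ^ e x) n = (if e x = n then c x else 0)" for x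
    by (simp add: fps_X_power_nth)
  show "finite {x \<in> A. fps_nth (fps_const (c x) * fps_X ^ e x) n \<noteq> 0}"
    by (rule finite_subset[OF _ assms[of n]]) (auto simp: nth split: if_splits)
  show "fps_nth (Abs_fps (\<lambda>n. \<Sum>x | x \<in> A \<and> e x = n. c x)) n
      = (\<Sum>x | x \<in> A \<and> fps_nth (fps_const (c x) * fps_X ^ e x) n \<noteq> 0.
          fps_nth (fps_const (c x) * fps_X ^ e x) n)"
    unfolding nth fps_nth_Abs_fps
    by (rule sum.mono_neutral_cong_right[OF assms[of n]]) (auto split: if_splits)
qed

lemma gauss_binomial_self: "gauss_binomial (int b) (int b) = 1"
  using sum_words[of b 0] by (simp add: monom_eq_1)

section \<open>Translation between sequences and weight counts\<close>

context weighted
begin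

text \<open>The weight at which the sequence starts. If \<open>s 1 > 0\<close>, then
  \<open>full (base s) = s 1\<close>, so the count is still full there; truncation gives
  \<open>0\<close> if \<open>s 1 = 0\<close>.\<close>

definition base :: "(nat \<Rightarrow> nat) \<Rightarrow> nat" where
  "base s = N * (s 1 - 1)"

definition seq_diag :: "(nat \<Rightarrow> nat) \<Rightarrow> nat \<Rightarrow> nat" where
  "seq_diag s q = (if q < base s then full q else s (Suc (q - base s)))"

text \<open>For admissible counts of finite support this is the number of full multiples of
  \<open>N\<close>, from which \<open>s 1\<close> is read off.\<close>

definition order_of :: "(nat \<Rightarrow> nat) \<Rightarrow> nat" where
  "order_of d = (LEAST r. d (N * r) \<noteq> full (N * r))"

definition diag_seq :: "(nat \<Rightarrow> nat) \<Rightarrow> nat \<Rightarrow> nat" where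
  "diag_seq d i = (if i = 0 then 0 else d (N * (order_of d - 1) + (i - 1)))"

lemma full_mult: "full (N * k) = Suc k"
  using N_pos by (simp add: full_def)

lemma full_base: "s 1 > 0 \<Longrightarrow> full (base s) = s 1"
  by (simp add: base_def full_mult)

lemma seqs_iff:
  "s \<in> seqs (Suc N) \<longleftrightarrow> s 0 = 0 \<and> finite {i. s i \<noteq> 0} \<and>
     (\<forall>i\<ge>1. s (Suc i) \<le> s i + of_bool (N dvd i) \<and> s (i + N) \<le> s i)"
proof -
  have "int (s i) \<ge> int (s (i + 1)) - of_bool (N dvd i) \<longleftrightarrow> s (Suc i) \<le> s i + of_bool (N dvd i)" for i
    by auto
  then show ?thesis unfolding seqs_def by auto
qed

lemma seqs_le_first:
  assumes "s \<in> seqs (Suc N)" "k < N"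
  shows "s (Suc k) \<le> s 1"
  using assms(2)
proof (induction k)
  case (Suc k)
  then have "\<not> N dvd Suc k" by (auto dest: dvd_imp_le)
  moreover have "s (Suc (Suc k)) \<le> s (Suc k) + of_bool (N dvd Suc k)"
    using assms(1) by (simp add: seqs_iff)
  ultimately show ?case using Suc by simp
qed simp

lemma seq_diag_admissible:
  assumes "s \<in> seqs (Suc N)"
  shows "admissible (seq_diag s)"
  unfolding admissible_def
proof (intro conjI allI)
  let ?b = "base s"
  have dvd_b: "N dvd ?b" by (simp add: base_def)
  have pos: "s 1 > 0" if "q < ?b" for q using that by (cases "s 1") (auto simp: base_def)
  show "seq_diag s 0 \<le> 1"
    using N_pos by (auto simp: seq_diag_def full_def base_def)
  fix q
  show "seq_diag s (Suc q) \<le> seq_diag s q + of_bool (N dvd Suc q)"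
  proof -
    consider "Suc q < ?b" | "Suc q = ?b" | "?b \<le> q" by linarith
    then show ?thesis
    proof cases
      case 1
      then show ?thesis by (simp add: seq_diag_def full_Suc)
    next
      case 2
      then have "full (Suc q) = s 1" using full_base pos[of q] by simp
      then show ?thesis using 2 full_Suc[of q] by (simp add: seq_diag_def)
    next
      case 3
      then have "N dvd Suc (q - ?b) \<longleftrightarrow> N dvd Suc q"
        using dvd_add_left_iff[OF dvd_b, of "Suc (q - ?b)"] by simp
      moreover have "s (Suc (Suc (q - ?b))) \<le> s (Suc (q - ?b)) + of_bool (N dvd Suc (q - ?b))"
        using assms by (simp add: seqs_iff)
      ultimately show ?thesis using 3 by (simp add: seq_diag_def Suc_diff_le)
    qed
  qed
  show "seq_diag s (q + N) \<le> seq_diag s q \<or> seq_diag s (q + N) = full (q + N)"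
  proof -
    consider "q + N < ?b" | "q < ?b" "?b \<le> q + N" | "?b \<le> q" by linarith
    then show ?thesis
    proof cases
      \<comment> \<open>The comparison crosses the start of the sequence. The value there is at most
        \<open>s 1 \<le> full (q + N) = full q + 1\<close>, hence at most \<open>full q\<close> or
        else full.\<close>
      case 2
      have "s (Suc (q + N - ?b)) \<le> s 1" by (rule seqs_le_first[OF assms]) (use 2 in simp)
      moreover have "s 1 \<le> full (q + N)"
        using full_mono[OF 2(2)] full_base[of s, OF pos[OF 2(1)]] by simp
      ultimately show ?thesis using 2 by (auto simp: seq_diag_def full_add)
    next
      case 3
      have "\<forall>i\<ge>1. s (i + N) \<le> s i" using assms by (simp add: seqs_iff)
      from this[rule_format, of "Suc (q - ?b)"] have "s (Suc (q - ?b) + N) \<le> s (Suc (q - ?b))" by simp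
      then show ?thesis using 3 by (simp add: seq_diag_def)
    qed (simp add: seq_diag_def)
  qed
qed

lemma order_of_seq_diag:
  assumes "s \<in> seqs (Suc N)"
  shows "order_of (seq_diag s) = s 1"
  unfolding order_of_def
proof (rule Least_equality)
  show "seq_diag s (N * s 1) \<noteq> full (N * s 1)"
  proof (cases "s 1")
    case (Suc k)
    \<comment> \<open>The weight \<open>N * s 1\<close> lies \<open>N\<close> above
      \<open>base s\<close>, so the value there is \<open>s (1 + N)\<close>, which falls short of
      \<open>full (N * s 1) = s 1 + 1\<close>.\<close>
    have "s (1 + N) \<le> s 1" using assms seqs_iff by blast
    then show ?thesis using Suc N_pos full_mult[of "Suc k"] by (simp add: seq_diag_def base_def)
  qed (simp add: seq_diag_def base_def full_def)
  fix k assume k: "seq_diag s (N * k) \<noteq> full (N * k)"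
  show "s 1 \<le> k"
  proof (rule ccontr)
    assume "\<not> s 1 \<le> k"
    then have "k < s 1 - 1 \<or> k = s 1 - 1" "s 1 > 0" by auto
    then show False using k N_pos by (auto simp: seq_diag_def base_def full_mult)
  qed
qed

lemma diag_seq_seq_diag:
  assumes "s \<in> seqs (Suc N)"
  shows "diag_seq (seq_diag s) = s"
  using assms order_of_seq_diag[OF assms]
  by (auto simp: diag_seq_def seq_diag_def base_def seqs_iff fun_eq_iff)

lemma order_of:
  assumes "\<forall>q\<ge>Q. d q = 0"
  shows "d (N * order_of d) \<noteq> full (N * order_of d)" "k < order_of d \<Longrightarrow> d (N * k) = full (N * k)"
proof -
  have "d (N * Q) = 0" using assms N_pos by simp
  then have "d (N * Q) \<noteq> full (N * Q)" by (simp add: full_def)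
  then show "d (N * order_of d) \<noteq> full (N * order_of d)" unfolding order_of_def by (rule LeastI)
  show "k < order_of d \<Longrightarrow> d (N * k) = full (N * k)"
    unfolding order_of_def using not_less_Least by blast
qed

lemma diag_seq:
  assumes "admissible d" "\<forall>q\<ge>Q. d q = 0"
  shows "diag_seq d \<in> seqs (Suc N)" "seq_diag (diag_seq d) = d"
proof -
  let ?r = "order_of d" and ?s = "diag_seq d"
  let ?b = "N * (?r - 1)"
  note ord = order_of[OF assms(2)]
  have step: "d (?b + Suc i) \<le> d (?b + i) + of_bool (N dvd Suc i)" for i
  proof -
    have "d (Suc (?b + i)) \<le> d (?b + i) + of_bool (N dvd Suc (?b + i))"
      using assms(1) by (simp add: admissible_def)
    moreover have "N dvd Suc (?b + i) \<longleftrightarrow> N dvd Suc i"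
      using dvd_add_right_iff[of N ?b "Suc i"] by simp
    ultimately show ?thesis by simp
  qed
  \<comment> \<open>From \<open>?b\<close> on, adding \<open>N\<close> reaches at least
    \<open>N * ?r\<close>, which is not full, so the alternative of full counts is excluded.\<close>
  have jump: "d (?b + i + N) \<le> d (?b + i)" for i
    by (rule admissible_add_le[OF assms(1) ord(1)]) (cases ?r, auto)
  have "finite {i. ?s i \<noteq> 0}"
  proof (rule finite_subset)
    have "?s i = 0" if "i > Q" for i
      using assms(2) that by (simp add: diag_seq_def)
    then show "{i. ?s i \<noteq> 0} \<subseteq> {..Q}" by (auto simp: not_less[symmetric])
  qed simp
  moreover have "?s (Suc i) \<le> ?s i + of_bool (N dvd i) \<and> ?s (i + N) \<le> ?s i" if "i \<ge> 1" for i
    using that step[of "i - 1"] jump[of "i - 1"] by (auto simp: diag_seq_def algebra_simps)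
  ultimately show "?s \<in> seqs (Suc N)" by (simp add: seqs_iff diag_seq_def)
  have s1: "?s 1 = ?r"
  proof (cases ?r)
    case 0
    then show ?thesis
      using ord(1) admissible_le_full[OF assms(1), of 0] by (simp add: diag_seq_def full_def)
  next
    case (Suc k)
    then show ?thesis using ord(2)[of k] by (simp add: diag_seq_def full_mult)
  qed
  have low: "d q = full q" if "q < ?b" for q
  proof (cases ?r)
    case (Suc k)
    then show ?thesis
      using ord(2)[of k] that admissible_full_down[OF assms(1), of "N * k" q] by simp
  qed (use that in simp)
  show "seq_diag ?s = d"
    using low s1 by (auto simp: seq_diag_def base_def diag_seq_def fun_eq_iff)
qed

text \<open>\<open>full\<close> is constant on blocks of \<open>N\<close> weights, so triangular
  numbers arise. For \<open>k = s 1 - 1\<close> this is the quadratic part of the exponent.\<close>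

lemma sum_full: "(\<Sum>q<N * k. full q) = N * (Suc k choose 2)"
proof (induction k)
  case (Suc k)
  have "(\<Sum>q<N * k + M. full q) = (\<Sum>q<N * k. full q) + M * Suc k" if "M \<le> N" for M
    using that by (induction M) (auto simp: full_def)
  from this[OF order_refl] have "(\<Sum>q<N * k + N. full q) = N * (Suc k choose 2) + N * Suc k"
    by (simp only: Suc)
  moreover have "(Suc (Suc k) choose 2) = (Suc k choose 2) + Suc k"
    by (simp add: numeral_2_eq_2)
  moreover have "N * Suc k = N * k + N" by simp
  ultimately show ?case by (simp only: distrib_left)
qed (simp add: numeral_2_eq_2)

text \<open>Shifting by \<open>base s\<close> turns the binomial at weight \<open>base s + j\<close>
  into \<open>factor\<close> at \<open>j \<ge> 1\<close>; all lower weights contribute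
  \<open>1\<close>.\<close>

lemma seq_diag_data:
  assumes "s \<in> seqs (Suc N)"
  obtains Q where "\<forall>q\<ge>Q. seq_diag s q = 0"
    "N * (s 1 choose 2) + Sum_any s = (\<Sum>q<Q. seq_diag s q)"
    "weight (Suc N) s = (\<Prod>q<Q. gauss_binomial
       (int (ones (seq_diag s) q + zeros (seq_diag s) q)) (int (ones (seq_diag s) q)))"
proof -
  let ?d = "seq_diag s" and ?b = "base s"
  let ?G = "\<lambda>q. gauss_binomial (int (ones ?d q + zeros ?d q)) (int (ones ?d q))"
  note adm = seq_diag_admissible[OF assms]
  have "finite {i. s i \<noteq> 0}" using assms by (simp add: seqs_iff)
  then obtain I where I: "\<And>i. s i \<noteq> 0 \<Longrightarrow> i < I"
    using finite_nat_set_iff_bounded by auto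
  have at: "?d (?b + i) = s (Suc i)" for i by (simp add: seq_diag_def)
  have split_sum: "(\<Sum>q<?b + k. ?d q) = (\<Sum>q<?b. full q) + (\<Sum>i<k. s (Suc i))" for k
    by (induction k) (simp_all add: at, simp add: seq_diag_def)
  have "Sum_any s = (\<Sum>i<Suc I. s i)"
    by (rule Sum_any.expand_superset) (use I in \<open>auto intro: less_SucI\<close>)
  also have "\<dots> = (\<Sum>i<I. s (Suc i))"
    using assms by (subst sum.lessThan_Suc_shift) (simp add: seqs_iff)
  finally have "Sum_any s = (\<Sum>i<I. s (Suc i))" .
  moreover have "(\<Sum>q<?b. full q) = N * (s 1 choose 2)"
    by (cases "s 1") (simp_all add: base_def sum_full)
  ultimately have size: "N * (s 1 choose 2) + Sum_any s = (\<Sum>q<?b + I. ?d q)"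
    by (simp add: split_sum)
  have full1: "?G q = 1" if "?d q = full q" for q
    using zeros_full[OF adm that] by (simp add: gauss_binomial_self)
  have G_low: "?G q = 1" if "q < ?b" for q
    by (rule full1) (use that in \<open>simp add: seq_diag_def\<close>)
  \<comment> \<open>This place corresponds to the index \<open>0\<close>, which
    \<open>weight\<close> omits. Either the count is full and there is no \<open>False\<close>, or
    \<open>s 1 = 0\<close> and there is no \<open>True\<close>.\<close>
  have G_base: "?G ?b = 1"
  proof (cases "s 1 > 0")
    case True
    then show ?thesis using at[of 0] full_base by (intro full1) simp
  next
    case False
    then have "ones ?d ?b = 0" using at[of 0] by (simp add: ones_def)
    then show ?thesis by (simp add: gauss_binomial_0_right)
  qed
  have G_factor: "?G (?b + j) = factor (Suc N) s j" if "j \<ge> 1" for j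
  proof -
    have "?d (?b + j) = s (Suc j)" "?d (?b + j - 1) = s j" "?d (?b + j + N) = s (j + Suc N)"
      using at[of j] at[of "j - 1"] at[of "j + N"] that by (simp_all add: add.assoc)
    moreover have "s (j + Suc N) \<le> s (Suc j)"
      using assms that by (simp add: seqs_iff) (metis Suc_leI add_Suc le_Suc_eq lessI)
    moreover have "N dvd ?b + j \<longleftrightarrow> N dvd j"
      by (rule dvd_add_right_iff) (simp add: base_def)
    moreover from calculation have "zeros ?d (?b + j) + s (Suc j) = s j + of_bool (N dvd j)"
      using admissible_zeros[OF adm, of "?b + j"] that by simp
    from arg_cong[OF this, of int]
    have "int (zeros ?d (?b + j)) + int (s (Suc j)) = int (s j) + of_bool (N dvd j)" by simp
    ultimately have "int (ones ?d (?b + j)) = int (s (j + 1)) - int (s (j + Suc N))"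
      "int (ones ?d (?b + j) + zeros ?d (?b + j)) = int (s j) - int (s (j + Suc N)) + of_bool (N dvd j)"
      by (simp_all add: ones_def)
    then show ?thesis by (simp only: factor_def diff_Suc_1)
  qed
  have "weight (Suc N) s = (\<Prod>j<I. if j \<ge> 1 then factor (Suc N) s j else 1)"
    unfolding weight_def
  proof (rule Prod_any.expand_superset)
    show "{j. (if 1 \<le> j then factor (Suc N) s j else 1) \<noteq> 1} \<subseteq> {..<I}"
    proof (rule subsetI, rule ccontr)
      fix j assume j: "j \<in> {j. (if 1 \<le> j then factor (Suc N) s j else 1) \<noteq> 1}" "j \<notin> {..<I}"
      then have "s j = 0" "s (j + 1) = 0" "s (j + Suc N) = 0"
        using I by (metis lessThan_iff, metis add_lessD1 lessThan_iff, metis add_lessD1 lessThan_iff)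
      then have "factor (Suc N) s j = 1" unfolding factor_def by (simp add: gauss_binomial_0_right)
      then show False using j(1) by (simp split: if_splits)
    qed
  qed simp
  also have "\<dots> = (\<Prod>j<I. ?G (?b + j))"
  proof (rule prod.cong)
    fix j
    show "(if j \<ge> 1 then factor (Suc N) s j else 1) = ?G (?b + j)"
      using G_factor[of j] G_base by (cases "j = 0") auto
  qed simp
  also have "\<dots> = (\<Prod>q<?b + I. ?G q)"
  proof -
    have "(\<Prod>q<?b + k. ?G q) = (\<Prod>j<k. ?G (?b + j))" for k
      by (induction k) (simp_all only: prod.lessThan_Suc add_Suc_right lessThan_0 prod.empty add_0_right,
          use G_low in auto)
    then show ?thesis by simp
  qed
  finally have weight: "weight (Suc N) s = (\<Prod>q<?b + I. ?G q)" .
  have "?d q = 0" if "q \<ge> ?b + I" for q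
    using at[of "q - ?b"] that I[of "Suc (q - ?b)"] by fastforce
  then show ?thesis using that[of "?b + I"] size weight by blast
qed

text \<open>Partitions are grouped by weight count. By \<open>fibre_nonempty\<close> the sequences
  of size \<open>n\<close> match exactly the counts realised by partitions of size \<open>n\<close>,
  which also transfers finiteness.\<close>

lemma coefficients:
  defines "E \<equiv> \<lambda>s. N * (s 1 choose 2) + Sum_any s"
  shows "finite {s \<in> seqs (Suc N). E s = n}"
    and "(\<Sum>\<mu> | \<mu> \<in> partitions \<and> psize \<mu> = n. monom 1 (h_count N 1 \<mu>))
       = (\<Sum>s | s \<in> seqs (Suc N) \<and> E s = n. weight (Suc N) s)"
proof -
  let ?A = "{\<mu>. \<mu> \<in> partitions \<and> psize \<mu> = n}" and ?S = "{s. s \<in> seqs (Suc N) \<and> E s = n}"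
  have size: "psize \<mu> = E s" if "s \<in> seqs (Suc N)" "diag \<mu> = seq_diag s" for \<mu> s
    using seq_diag_data[OF that(1)] that(2) psize_diag[of _ \<mu>] unfolding E_def by metis
  have fibres: "{\<mu> \<in> ?A. diag \<mu> = seq_diag s} = fibre (seq_diag s)" if "s \<in> ?S" for s
    using that size by (auto simp: fibre_def)
  have "seq_diag ` ?S = diag ` ?A"
  proof (intro set_eqI iffI)
    fix d assume "d \<in> seq_diag ` ?S"
    then obtain s where s: "s \<in> ?S" "d = seq_diag s" by blast
    then have "s \<in> seqs (Suc N)" by simp
    then have "fibre (seq_diag s) \<noteq> {}"
      by (metis seq_diag_data seq_diag_admissible fibre_nonempty)
    then obtain \<mu> where "\<mu> \<in> ?A" "diag \<mu> = seq_diag s" using fibres[OF s(1)] by blast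
    then show "d \<in> diag ` ?A" using s(2) by (intro image_eqI[of _ _ \<mu>]) auto
  next
    fix d assume "d \<in> diag ` ?A"
    then obtain \<mu> where \<mu>: "\<mu> \<in> partitions" "psize \<mu> = n" "d = diag \<mu>" by blast
    obtain Q where "\<forall>q\<ge>Q. diag \<mu> q = 0" using diag_finite_support by blast
    note s = diag_seq[OF diag_admissible[OF \<mu>(1)] this]
    then show "d \<in> seq_diag ` ?S"
      using size[OF s(1), of \<mu>] \<mu> by (intro image_eqI[of _ _ "diag_seq d"]) auto
  qed
  moreover have "inj_on seq_diag ?S"
    by (rule inj_on_inverseI[of _ diag_seq]) (auto simp: diag_seq_seq_diag)
  ultimately have bij: "bij_betw seq_diag ?S (diag ` ?A)" by (simp add: bij_betw_def)
  have finA: "finite ?A" by (rule finite_partitions_psize)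
  then show "finite {s \<in> seqs (Suc N). E s = n}" using bij_betw_finite[OF bij] by simp
  have "(\<Sum>\<mu>\<in>?A. monom 1 (h_count N 1 \<mu>))
      = (\<Sum>d\<in>diag ` ?A. \<Sum>\<mu> | \<mu> \<in> ?A \<and> diag \<mu> = d. monom 1 (h_count N 1 \<mu>))"
    by (rule sum.image_gen[OF finA])
  also have "\<dots> = (\<Sum>s\<in>?S. \<Sum>\<mu> | \<mu> \<in> ?A \<and> diag \<mu> = seq_diag s. monom 1 (h_count N 1 \<mu>))"
    by (rule sum.reindex_bij_betw[OF bij, symmetric])
  also have "\<dots> = (\<Sum>s\<in>?S. weight (Suc N) s)"
  proof (rule sum.cong)
    fix s assume s: "s \<in> ?S"
    then have "s \<in> seqs (Suc N)" by simp
    then obtain Q where Q: "\<forall>q\<ge>Q. seq_diag s q = 0"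
      "weight (Suc N) s = (\<Prod>q<Q. gauss_binomial
         (int (ones (seq_diag s) q + zeros (seq_diag s) q)) (int (ones (seq_diag s) q)))"
      by (rule seq_diag_data)
    have "(\<Sum>\<mu>\<in>fibre (seq_diag s). monom 1 (h_count N 1 \<mu>)) = weight (Suc N) s"
      unfolding sum_fibre_codes[OF seq_diag_admissible[OF \<open>s \<in> seqs (Suc N)\<close>] Q(1)]
      by (simp only: Q(2) sum_codes[OF Q(1)])
    then show "(\<Sum>\<mu> | \<mu> \<in> ?A \<and> diag \<mu> = seq_diag s. monom 1 (h_count N 1 \<mu>)) = weight (Suc N) s"
      unfolding fibres[OF s] .
  qed simp
  finally show "(\<Sum>\<mu>\<in>?A. monom 1 (h_count N 1 \<mu>)) = (\<Sum>s\<in>?S. weight (Suc N) s)" .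
qed

end

theorem theorem3p1:
  fixes m :: nat
  assumes "m \<ge> 2"
  shows "(\<lambda>\<mu>. fps_const (monom (1::int) (h_count (m - 1) 1 \<mu>)) * fps_X ^ psize \<mu>)
           summable_on partitions
    \<and> (\<lambda>s. fps_const (weight m s) * fps_X ^ ((m - 1) * (s 1 choose 2) + Sum_any s))
           summable_on seqs m
    \<and> (\<Sum>\<^sub>\<infinity>\<mu>\<in>partitions.
            fps_const (monom (1::int) (h_count (m - 1) 1 \<mu>)) * fps_X ^ psize \<mu>)
         = (\<Sum>\<^sub>\<infinity>s\<in>seqs m.
            fps_const (weight m s) * fps_X ^ ((m - 1) * (s 1 choose 2) + Sum_any s))"
proof -
  interpret weighted "m - 1" by standard (use assms in simp)
  have m: "Suc (m - 1) = m" using assms by simp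
  let ?c = "\<lambda>\<mu>. monom (1::int) (h_count (m - 1) 1 \<mu>)"
  let ?e = "\<lambda>s. (m - 1) * (s 1 choose 2) + Sum_any s"
  have P: "((\<lambda>\<mu>. fps_const (?c \<mu>) * fps_X ^ psize \<mu>) has_sum
      Abs_fps (\<lambda>n. \<Sum>\<mu> | \<mu> \<in> partitions \<and> psize \<mu> = n. ?c \<mu>)) partitions"
    by (rule has_sum_fps_graded[OF finite_partitions_psize])
  have "((\<lambda>s. fps_const (weight m s) * fps_X ^ ?e s) has_sum
      Abs_fps (\<lambda>n. \<Sum>s | s \<in> seqs m \<and> ?e s = n. weight m s)) (seqs m)"
    by (rule has_sum_fps_graded[OF coefficients(1)[unfolded m]])
  \<comment> \<open>Equality of coefficients makes both families sum to the same power
    series.\<close>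
  then have S: "((\<lambda>s. fps_const (weight m s) * fps_X ^ ?e s) has_sum
      Abs_fps (\<lambda>n. \<Sum>\<mu> | \<mu> \<in> partitions \<and> psize \<mu> = n. ?c \<mu>)) (seqs m)"
    unfolding coefficients(2)[unfolded m] .
  show ?thesis
    using has_sum_imp_summable[OF P] has_sum_imp_summable[OF S] infsumI[OF P] infsumI[OF S]
    by simp
qed

end
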